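(* Let $d\ge2$ and let $M$ be a finite connected multigraph without loops, with vertices $0,1,\dots,n-1$. Let $x_0,\dots,x_{n-1}\in\mathbb R^d$ be a placement of the vertices of the reduced graph of $M$ (adjacent vertices being placed at distinct points). For every edge $ij$ of the reduced graph let $m_{ij}$ be its multiplicity in $M$, and let $e_{ij}^1,\dots,e_{ij}^{m_{ij}}\in\mathbb R^d$ be pairwise distinct nonzero vectors such that each endpoint $x_i+e_{ij}^k$ lies on the sphere having the segment from $x_i$ to $x_j$ as a diameter (and put $e_{ji}^k=-e_{ij}^k$). Assume that the $\mathbb Z$-span $L$ of all periodicity vectors is a lattice of rank $d$ in $\mathbb R^d$, where a periodicity vector is either a difference $e_{ij}^k-e_{ij}^l$ of two vectors in the same sphere, or a sum $e_{i_1i_2}^{k_1}+e_{i_2i_3}^{k_2}+\dots+e_{i_Ji_1}^{k_J}$ over a cycle $i_1,i_2,\dots,i_J,i_1$ of the reduced graph. Then there is a periodic framework $\mathcal F=(G,\Gamma,p,\pi)$ in $\mathbb R^d$ with quotient multigraph $G/\Gamma\cong M$, with periodicity lattice $\pi(\Gamma)=L$, and whose Cartesian edge vectors from the vertex orbit $i$ to the vertex orbit $j$ are exactly the vectors $e_{ij}^1,\dots,e_{ij}^{m_{ij}}$, and this framework has a strictly auxetic infinitesimal deformation. Moreover, if all points $x_i$ and all endpoints $x_i+e_{ij}^k$ have rational coordinates and the periodicity vectors span $\mathbb R^d$ over $\mathbb R$, then the assumption that $L$ is a lattice of rank $d$ is automatically satisfied.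
   Context: The reduced graph of a multigraph is obtained by replacing multiple edges by simple edges. A $d$-periodic graph is a pair $(G,\Gamma)$, where $G=(V,E)$ is a connected simple infinite graph with finite degree at every vertex, and $\Gamma\subset \mathrm{Aut}(G)$ is a free Abelian group of rank $d$ acting without fixed points and with finitely many vertex orbits; $G/\Gamma=(V/\Gamma,E/\Gamma)$ is its quotient multigraph. A periodic framework $\mathcal F=(G,\Gamma,p,\pi)$ in $\mathbb R^d$ is a $d$-periodic graph with a map $p:V\to\mathbb R^d$ and an injective homomorphism $\pi$ from $\Gamma$ to the group of translations of $\mathbb R^d$ (identified with $\mathbb R^d$) whose image is a lattice of rank $d$, such that $p(\gamma v)=\pi(\gamma)(p(v))$. Choose $d$ independent generators of $\Gamma$ and let $\Lambda$ be the $d\times d$ matrix whose columns are their images under $\pi$; put $\omega=\Lambda^t\Lambda$ (Gram matrix). Choose representatives $v_0,\dots,v_{n-1}$ of the vertex orbits, put $p_i=p(v_i)$, and define lattice coordinates by $q_0=0$, $\Lambda q_i=p_i-p_0$. An edge going from $v_i$ to a vertex in the orbit of $v_j$ has Cartesian edge vector $p_j+\Lambda n_{ij}-p_i$ with $n_{ij}\in\mathbb Z^d$, and edge vector $e_{ij}=q_j+n_{ij}-q_i$ in lattice coordinates. An infinitesimal deformation of $\mathcal F$ is a tuple $(\dot q_1,\dots,\dot q_{n-1},\dot\omega)$, with $\dot q_i\in\mathbb R^d$, $\dot q_0=0$, and $\dot\omega$ a symmetric real $d\times d$ matrix, such that for every edge, with edge vector $e_{ij}$ in lattice coordinates, $$\langle\dot\omega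 e_{ij},e_{ij}\rangle+2\langle\omega(\dot q_j-\dot q_i),e_{ij}\rangle=0 .$$ It is strictly auxetic if $\dot\omega$ is positive definite. *)

theory Defs
  imports
    "HOL-Analysis.Analysis"
    "HOL-Algebra.Bij"
    "HOL-Algebra.Group_Action"
    "HOL-Algebra.FiniteProduct"
    "HOL-Algebra.Generated_Groups"
    "HOL-Algebra.Free_Abelian_Groups"
    "HOL-Computational_Algebra.Group_Closure"
begin

section \<open>Simple graphs and multigraphs\<close>

text \<open>An edge of a simple graph is the set of its two ends; the edges of a multigraph are
  abstract objects with a set of one (loop) or two ends.\<close>

record 'v sgraph =
  sverts :: "'v set"
  sedges :: "'v set set"

record ('v, 'e) multigraph =
  mverts :: "'v set"
  medges :: "'e set"
  mends :: "'e \<Rightarrow> 'v set"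

definition simple_graph :: "'v sgraph \<Rightarrow> bool" where
  "simple_graph G \<longleftrightarrow> (\<forall>X\<in>sedges G. X \<subseteq> sverts G \<and> card X = 2)"

definition connected_graph :: "'v sgraph \<Rightarrow> bool" where
  "connected_graph G \<longleftrightarrow> sverts G \<noteq> {} \<and>
     (\<forall>u\<in>sverts G. \<forall>v\<in>sverts G. (u, v) \<in> {(a, b). {a, b} \<in> sedges G}\<^sup>*)"

definition multigraph :: "('v, 'e) multigraph \<Rightarrow> bool" where
  "multigraph M \<longleftrightarrow> (\<forall>a\<in>medges M. mends M a \<subseteq> mverts M \<and> card (mends M a) \<in> {1, 2})"

definition loopless :: "('v, 'e) multigraph \<Rightarrow> bool" where
  "loopless M \<longleftrightarrow> (\<forall>a\<in>medges M. card (mends M a) \<noteq> 1)"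

definition finite_multigraph :: "('v, 'e) multigraph \<Rightarrow> bool" where
  "finite_multigraph M \<longleftrightarrow> finite (mverts M) \<and> finite (medges M)"

text \<open>Used for loopless multigraphs only, where the result is a simple graph.\<close>

definition reduced_graph :: "('v, 'e) multigraph \<Rightarrow> 'v sgraph" where
  "reduced_graph M = \<lparr>sverts = mverts M, sedges = mends M ` medges M\<rparr>"

definition multiplicity_of :: "('v, 'e) multigraph \<Rightarrow> 'v \<Rightarrow> 'v \<Rightarrow> nat" where
  "multiplicity_of M i j = card {a \<in> medges M. mends M a = {i, j}}"

definition multigraph_iso ::
    "('v \<Rightarrow> 'w) \<Rightarrow> ('e \<Rightarrow> 'f) \<Rightarrow> ('v, 'e) multigraph \<Rightarrow> ('w, 'f) multigraph \<Rightarrow> bool" where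
  "multigraph_iso f g M N \<longleftrightarrow>
     bij_betw f (mverts M) (mverts N) \<and> bij_betw g (medges M) (medges N) \<and>
     (\<forall>a\<in>medges M. mends N (g a) = f ` mends M a)"

definition is_cycle :: "'v sgraph \<Rightarrow> 'v list \<Rightarrow> bool" where
  "is_cycle G c \<longleftrightarrow> 3 \<le> length c \<and> distinct c \<and>
     (\<forall>t<length c. {c ! t, c ! (Suc t mod length c)} \<in> sedges G)"


section \<open>Periodic graphs\<close>

text \<open>Automorphisms are extensional functions on the vertex set, as in \<^const>\<open>BijGroup\<close>.\<close>

definition graph_aut :: "'v sgraph \<Rightarrow> ('v \<Rightarrow> 'v) set" where
  "graph_aut G = {f \<in> Bij (sverts G).
     \<forall>u\<in>sverts G. \<forall>v\<in>sverts G. {f u, f v} \<in> sedges G \<longleftrightarrow> {u, v} \<in> sedges G}"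

definition graph_aut_group :: "'v sgraph \<Rightarrow> ('v \<Rightarrow> 'v) monoid" where
  "graph_aut_group G = (BijGroup (sverts G))\<lparr>carrier := graph_aut G\<rparr>"

definition period_group :: "'v sgraph \<Rightarrow> ('v \<Rightarrow> 'v) set \<Rightarrow> ('v \<Rightarrow> 'v) monoid" where
  "period_group G \<Gamma> = (graph_aut_group G)\<lparr>carrier := \<Gamma>\<rparr>"

definition vertex_orbit :: "'v sgraph \<Rightarrow> ('v \<Rightarrow> 'v) set \<Rightarrow> 'v \<Rightarrow> 'v set" where
  "vertex_orbit G \<Gamma> v = orbit (period_group G \<Gamma>) (\<lambda>\<gamma>. \<gamma>) v"

definition vertex_orbits :: "'v sgraph \<Rightarrow> ('v \<Rightarrow> 'v) set \<Rightarrow> 'v set set" where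
  "vertex_orbits G \<Gamma> = orbits (period_group G \<Gamma>) (sverts G) (\<lambda>\<gamma>. \<gamma>)"

definition edge_orbits :: "'v sgraph \<Rightarrow> ('v \<Rightarrow> 'v) set \<Rightarrow> 'v set set set" where
  "edge_orbits G \<Gamma> = orbits (period_group G \<Gamma>) (sedges G) (\<lambda>\<gamma> X. \<gamma> ` X)"

definition periodic_graph :: "nat \<Rightarrow> 'v sgraph \<Rightarrow> ('v \<Rightarrow> 'v) set \<Rightarrow> bool" where
  "periodic_graph d G \<Gamma> \<longleftrightarrow>
     simple_graph G \<and> connected_graph G \<and> infinite (sverts G) \<and>
     (\<forall>v\<in>sverts G. finite {w. {v, w} \<in> sedges G}) \<and>
     subgroup \<Gamma> (graph_aut_group G) \<and>
     period_group G \<Gamma> \<cong> free_Abelian_group {..<d} \<and>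
     (\<forall>\<gamma>\<in>\<Gamma>. (\<exists>v\<in>sverts G. \<gamma> v = v) \<longrightarrow> \<gamma> = \<one>\<^bsub>period_group G \<Gamma>\<^esub>) \<and>
     finite (vertex_orbits G \<Gamma>)"

text \<open>The ends of an edge orbit are the orbits of the ends of its members.\<close>

definition quotient_multigraph ::
    "'v sgraph \<Rightarrow> ('v \<Rightarrow> 'v) set \<Rightarrow> ('v set, 'v set set) multigraph" where
  "quotient_multigraph G \<Gamma> =
     \<lparr>mverts = vertex_orbits G \<Gamma>, medges = edge_orbits G \<Gamma>,
      mends = (\<lambda>\<epsilon>. vertex_orbit G \<Gamma> ` \<Union>\<epsilon>)\<rparr>"


section \<open>Periodic frameworks\<close>

definition lattice_of_rank :: "nat \<Rightarrow> (real ^ 'd) set \<Rightarrow> bool" where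
  "lattice_of_rank r L \<longleftrightarrow>
     (\<exists>B. finite B \<and> card B = r \<and> independent B \<and> L = group_closure B)"

text \<open>A translation of \<open>\<real>\<^sup>d\<close> is identified with its translation vector.\<close>

definition periodic_framework ::
    "'v sgraph \<Rightarrow> ('v \<Rightarrow> 'v) set \<Rightarrow> ('v \<Rightarrow> real ^ 'd) \<Rightarrow> (('v \<Rightarrow> 'v) \<Rightarrow> real ^ 'd) \<Rightarrow> bool" where
  "periodic_framework G \<Gamma> p \<pi> \<longleftrightarrow>
     periodic_graph CARD('d) G \<Gamma> \<and>
     (\<forall>\<gamma>\<in>\<Gamma>. \<forall>\<delta>\<in>\<Gamma>. \<pi> (\<gamma> \<otimes>\<^bsub>period_group G \<Gamma>\<^esub> \<delta>) = \<pi> \<gamma> + \<pi> \<delta>) \<and>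
     inj_on \<pi> \<Gamma> \<and> lattice_of_rank CARD('d) (\<pi> ` \<Gamma>) \<and>
     (\<forall>\<gamma>\<in>\<Gamma>. \<forall>v\<in>sverts G. p (\<gamma> v) = p v + \<pi> \<gamma>)"

definition edge_vectors_between ::
    "'v sgraph \<Rightarrow> ('v \<Rightarrow> real ^ 'd) \<Rightarrow> 'v set \<Rightarrow> 'v set \<Rightarrow> (real ^ 'd) set" where
  "edge_vectors_between G p A B = {p w - p u | u w. u \<in> A \<and> w \<in> B \<and> {u, w} \<in> sedges G}"

definition independent_generators ::
    "'v sgraph \<Rightarrow> ('v \<Rightarrow> 'v) set \<Rightarrow> ('d::finite \<Rightarrow> 'v \<Rightarrow> 'v) \<Rightarrow> bool" where
  "independent_generators G \<Gamma> g \<longleftrightarrow>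
     range g \<subseteq> \<Gamma> \<and> generate (period_group G \<Gamma>) (range g) = \<Gamma> \<and>
     (\<forall>k :: 'd \<Rightarrow> int.
        finprod (period_group G \<Gamma>) (\<lambda>s. g s [^]\<^bsub>period_group G \<Gamma>\<^esub> k s) UNIV
          = \<one>\<^bsub>period_group G \<Gamma>\<^esub> \<longrightarrow> (\<forall>s. k s = 0))"

definition orbit_representatives ::
    "'v sgraph \<Rightarrow> ('v \<Rightarrow> 'v) set \<Rightarrow> nat \<Rightarrow> (nat \<Rightarrow> 'v) \<Rightarrow> bool" where
  "orbit_representatives G \<Gamma> n v \<longleftrightarrow>
     v ` {..<n} \<subseteq> sverts G \<and>
     bij_betw (\<lambda>i. vertex_orbit G \<Gamma> (v i)) {..<n} (vertex_orbits G \<Gamma>)"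

definition lattice_matrix ::
    "(('v \<Rightarrow> 'v) \<Rightarrow> real ^ 'd) \<Rightarrow> ('d \<Rightarrow> 'v \<Rightarrow> 'v) \<Rightarrow> real ^ 'd ^ 'd" where
  "lattice_matrix \<pi> g = (\<chi> r c. \<pi> (g c) $ r)"

definition gram_matrix :: "real ^ 'd ^ 'd \<Rightarrow> real ^ 'd ^ 'd" where
  "gram_matrix \<Lambda> = transpose \<Lambda> ** \<Lambda>"

text \<open>The solution \<open>q\<^sub>i\<close> of \<open>\<Lambda> q\<^sub>i = p\<^sub>i - p\<^sub>0\<close>.\<close>

definition lattice_coord ::
    "real ^ 'd ^ 'd \<Rightarrow> ('v \<Rightarrow> real ^ 'd) \<Rightarrow> (nat \<Rightarrow> 'v) \<Rightarrow> nat \<Rightarrow> real ^ 'd" where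
  "lattice_coord \<Lambda> p v i = matrix_inv \<Lambda> *v (p (v i) - p (v 0))"

definition vec_of_int :: "int ^ 'd \<Rightarrow> real ^ 'd" where
  "vec_of_int z = (\<chi> s. of_int (z $ s))"

text \<open>Every edge of the framework has a translate starting at some \<open>v i\<close>. If that translate
  goes to \<open>w\<close> in the orbit of \<open>v j\<close>, then \<open>z\<close> below is the unique integer vector
  \<open>n\<^sub>i\<^sub>j\<close>, and \<open>e\<close> is the edge vector in lattice coordinates.\<close>

definition infinitesimal_deformation ::
    "'v sgraph \<Rightarrow> ('v \<Rightarrow> 'v) set \<Rightarrow> ('v \<Rightarrow> real ^ 'd) \<Rightarrow> (('v \<Rightarrow> 'v) \<Rightarrow> real ^ 'd) \<Rightarrow>
     ('d \<Rightarrow> 'v \<Rightarrow> 'v) \<Rightarrow> nat \<Rightarrow> (nat \<Rightarrow> 'v) \<Rightarrow> (nat \<Rightarrow> real ^ 'd) \<Rightarrow> real ^ 'd ^ 'd \<Rightarrow> bool" where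
  "infinitesimal_deformation G \<Gamma> p \<pi> g n v q' \<omega>' \<longleftrightarrow>
     (let \<Lambda> = lattice_matrix \<pi> g; \<omega> = gram_matrix \<Lambda>; q = lattice_coord \<Lambda> p v in
      q' 0 = 0 \<and> transpose \<omega>' = \<omega>' \<and>
      (\<forall>i<n. \<forall>j<n. \<forall>w\<in>vertex_orbit G \<Gamma> (v j). \<forall>z.
         {v i, w} \<in> sedges G \<and> p w - p (v i) = p (v j) + \<Lambda> *v vec_of_int z - p (v i) \<longrightarrow>
         (let e = q j + vec_of_int z - q i in
          inner (\<omega>' *v e) e + 2 * inner (\<omega> *v (q' j - q' i)) e = 0)))"

definition positive_definite :: "real ^ 'd ^ 'd \<Rightarrow> bool" where
  "positive_definite A \<longleftrightarrow> transpose A = A \<and> (\<forall>y. y \<noteq> 0 \<longrightarrow> inner (A *v y) y > 0)"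

text \<open>Infinitesimal deformations are written with respect to a choice of independent generators
  of \<open>\<Gamma>\<close> and of ordered orbit representatives. Such choices exist for every periodic framework;
  we ask for a deformation with respect to each of them.\<close>

definition has_strictly_auxetic_deformation ::
    "'v sgraph \<Rightarrow> ('v \<Rightarrow> 'v) set \<Rightarrow> ('v \<Rightarrow> real ^ 'd) \<Rightarrow> (('v \<Rightarrow> 'v) \<Rightarrow> real ^ 'd) \<Rightarrow> bool" where
  "has_strictly_auxetic_deformation G \<Gamma> p \<pi> \<longleftrightarrow>
     (\<forall>g n v. independent_generators G \<Gamma> g \<and> orbit_representatives G \<Gamma> n v \<longrightarrow>
        (\<exists>q' \<omega>'. infinitesimal_deformation G \<Gamma> p \<pi> g n v q' \<omega>' \<and> positive_definite \<omega>'))"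


section \<open>Periodicity vectors\<close>

text \<open>Here \<open>e i j k\<close>, for \<open>1 \<le> k \<le> multiplicity_of M i j\<close>, are the prescribed edge vectors
  from \<open>i\<close> to \<open>j\<close>. The second set contains one vector for every cycle and every choice
  \<open>\<kappa>\<close> of an edge vector along each of its steps.\<close>

definition periodicity_vectors ::
    "('v, 'e) multigraph \<Rightarrow> ('v \<Rightarrow> 'v \<Rightarrow> nat \<Rightarrow> real ^ 'd) \<Rightarrow> (real ^ 'd) set" where
  "periodicity_vectors M e =
     {e i j k - e i j l | i j k l. {i, j} \<in> sedges (reduced_graph M) \<and>
        k \<in> {1..multiplicity_of M i j} \<and> l \<in> {1..multiplicity_of M i j}} \<union>
     {(\<Sum>t<length c. e (c ! t) (c ! (Suc t mod length c)) (\<kappa> t)) | c \<kappa>.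
        is_cycle (reduced_graph M) c \<and>
        (\<forall>t<length c. \<kappa> t \<in> {1..multiplicity_of M (c ! t) (c ! (Suc t mod length c))})}"

end

theory Submission
  imports Defs
begin

text \<open>
  The strictly auxetic deformation comes from Thales' theorem. An edge vector \<open>w\<close> from \<open>i\<close> to
  \<open>j\<close> ends on the sphere with diameter from \<open>x i\<close> to \<open>x j\<close> exactly if
  \<open>\<langle>w, w\<rangle> = \<langle>x j - x i, w\<rangle>\<close>. The left-hand side is half of the first-order change of
  \<open>|w|\<^sup>2\<close> when the Gram matrix \<open>\<omega>\<close> changes by \<open>2 \<omega>\<close>, and the right-hand side is half of
  the change caused by moving the vertex orbits \<open>i\<close> with Cartesian velocities \<open>x i\<close>. Hence inflating
  the lattice uniformly and moving the orbits with velocities \<open>- x i\<close> preserves all edge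
  lengths to first order, and \<open>2 \<omega>\<close> is positive definite. This is
  \<open>strictly_auxetic_if_spherical\<close>, for an arbitrary framework.

  The framework itself is the covering graph of the multigraph whose sheets are indexed by
  the lattice. Call the sum of the edge vectors along a walk its sum. The point is that the
  sums of the closed walks at any fixed vertex form exactly the group \<open>L\<close>: every closed walk
  decomposes into cycles and pairs of parallel edges (\<open>closed_walk_period\<close>), and conversely
  every generator is the sum of a closed walk, which can be conjugated to any base vertex
  (\<open>period_closed_walk\<close>). Placing each vertex \<open>i\<close> at the sum \<open>P i\<close> of some walk from a base
  vertex, one has \<open>w \<in> P j - P i + L\<close> for every edge vector \<open>w\<close> from \<open>i\<close> to \<open>j\<close>. The vertices
  of the cover are the pairs \<open>(i, z)\<close> placed at \<open>P i + A z\<close>, where \<open>A\<close> is a basis matrix of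
  \<open>L\<close>, and two of them are adjacent if their difference is a prescribed edge vector. Since
  closed walks have their sums in \<open>L\<close>, every prescribed edge vector occurs in the cover; since
  they attain all of \<open>L\<close>, the cover is connected. Orbits of edges correspond to edges of the multigraph because the
  prescribed vectors of a pair of ends are distinct (\<open>edge_orbits_cover\<close>).

  For rational data, \<open>L\<close> has bounded denominators, and a spanning group with bounded
  denominators is a lattice: a tuple of independent vectors of minimal determinant is a
  basis (\<open>lattice_of_rank_if_bounded_denominators\<close>).
\<close>

section \<open>Lattices as images of the integer vectors\<close>

lemma vec_of_int_simps [simp]:
  "vec_of_int 0 = 0"
  "vec_of_int (y + z) = vec_of_int y + vec_of_int z"
  "vec_of_int (y - z) = vec_of_int y - vec_of_int z"
  "vec_of_int (- y) = - vec_of_int y"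
  "vec_of_int (axis s 1) = axis s 1"
  by (simp_all add: vec_of_int_def vec_eq_iff axis_def)

lemma vec_of_int_eq_iff [simp]: "vec_of_int y = vec_of_int z \<longleftrightarrow> y = z"
  by (simp add: vec_of_int_def vec_eq_iff)

lemma group_closure_sum_closed:
  "(\<And>i. i \<in> I \<Longrightarrow> f i \<in> group_closure S) \<Longrightarrow> sum f I \<in> group_closure S"
  by (induction I rule: infinite_finite_induct) (auto intro: group_closure_add)

lemma group_closure_of_int_scaleR:
  fixes v :: "'a::real_vector"
  assumes "v \<in> group_closure S"
  shows "of_int k *\<^sub>R v \<in> group_closure S"
proof -
  have nat: "of_nat m *\<^sub>R v \<in> group_closure S" for m
    by (induction m) (auto simp: algebra_simps intro: group_closure_add assms)
  show ?thesis
  proof (cases "k \<ge> 0")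
    case True
    then show ?thesis using nat[of "nat k"] by simp
  next
    case False
    then have "of_int k *\<^sub>R v = - (of_nat (nat (- k)) *\<^sub>R v)"
      by simp
    then show ?thesis using nat[of "nat (- k)"] by (simp only: group_closure_minus_iff)
  qed
qed

lemma group_closure_subset:
  assumes "S \<subseteq> H" "0 \<in> H" "\<And>v w. v \<in> H \<Longrightarrow> w \<in> H \<Longrightarrow> v - w \<in> H"
  shows "group_closure S \<subseteq> H"
proof
  fix v assume "v \<in> group_closure S"
  then show "v \<in> H" by induction (use assms in auto)
qed

lemma group_closure_columns:
  fixes A :: "real^'d^'d"
  shows "group_closure (columns A) = range (\<lambda>z. A *v vec_of_int z)"
proof
  have "columns A \<subseteq> range (\<lambda>z. A *v vec_of_int z)"
  proof
    fix v assume "v \<in> columns A"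
    then obtain s where "v = column s A" by (auto simp: columns_def)
    then have "v = A *v vec_of_int (axis s 1)" by (simp add: matrix_vector_mult_basis)
    then show "v \<in> range (\<lambda>z. A *v vec_of_int z)" by blast
  qed
  moreover have "0 \<in> range (\<lambda>z. A *v vec_of_int z)"
    by (rule range_eqI[of _ _ 0]) simp
  moreover have "v - w \<in> range (\<lambda>z. A *v vec_of_int z)"
    if "v \<in> range (\<lambda>z. A *v vec_of_int z)" "w \<in> range (\<lambda>z. A *v vec_of_int z)" for v w
    using that by (auto simp: matrix_vector_mult_diff_distrib[symmetric] simp flip: vec_of_int_simps)
  ultimately show "group_closure (columns A) \<subseteq> range (\<lambda>z. A *v vec_of_int z)"
    by (intro group_closure_subset)
  show "range (\<lambda>z. A *v vec_of_int z) \<subseteq> group_closure (columns A)"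
  proof clarify
    fix z :: "int^'d"
    have "A *v vec_of_int z = (\<Sum>s\<in>UNIV. of_int (z $ s) *\<^sub>R column s A)"
      by (simp add: matrix_mult_sum vec_of_int_def scalar_mult_eq_scaleR)
    also have "\<dots> \<in> group_closure (columns A)"
      by (intro group_closure_sum_closed group_closure_of_int_scaleR group_closure.base)
        (auto simp: columns_def)
    finally show "A *v vec_of_int z \<in> group_closure (columns A)" .
  qed
qed

lemma matrix_mult_inv_vector:
  fixes A :: "real^'d^'d"
  assumes "det A \<noteq> 0"
  shows "A *v (matrix_inv A *v y) = y"
proof -
  have "\<exists>A'. A ** A' = mat 1 \<and> A' ** A = mat 1"
    using assms by (simp add: invertible_det_nz[symmetric] invertible_def)
  then have "A ** matrix_inv A = mat 1"
    unfolding matrix_inv_def by (rule someI2_ex) simp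
  then show ?thesis by (simp add: matrix_vector_mul_assoc)
qed

lemma matrix_with_columns:
  assumes "finite B" "card B = CARD('d)"
  obtains A :: "real^'d^'d" where "columns A = B" 
proof -
  obtain b where b: "bij_betw b (UNIV :: 'd set) B"
    using finite_same_card_bij[of "UNIV :: 'd set" B] assms by auto
  have "column s (\<chi> i j. b j $ i) = b s" for s
    by (simp add: column_def)
  then have "columns (\<chi> i j. b j $ i) = B"
    using b by (auto simp: columns_def bij_betw_def)
  then show thesis by (rule that)
qed

lemma det_nonzero_if_span_columns:
  fixes A :: "real^'d^'d"
  assumes "span (columns A) = UNIV"
  shows "det A \<noteq> 0"
proof -
  obtain A' where "A ** A' = mat 1"
    using assms matrix_right_invertible_span_columns[of A] by (auto simp: span_vec_eq)
  then show ?thesis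
    by (metis invertible_det_nz invertible_right_inverse)
qed

text \<open>A basis matrix puts the lattice in bijection with the integer vectors; everything below
  works with these coordinates instead of an abstract basis.\<close>

lemma lattice_of_full_rank_iff:
  fixes L :: "(real^'d) set"
  shows "lattice_of_rank CARD('d) L \<longleftrightarrow>
    (\<exists>A :: real^'d^'d. det A \<noteq> 0 \<and> L = range (\<lambda>z. A *v vec_of_int z))"
proof
  assume "lattice_of_rank CARD('d) L"
  then obtain B where B: "finite B" "card B = CARD('d)" "independent B" "L = group_closure B"
    by (auto simp: lattice_of_rank_def)
  obtain A :: "real^'d^'d" where A: "columns A = B"
    using matrix_with_columns B(1,2) by blast
  have "span B = UNIV"
    using B dim_eq_full[of B] by (simp add: dim_eq_card_independent)
  then have "det A \<noteq> 0"
    using A by (intro det_nonzero_if_span_columns) simp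
  then show "\<exists>A :: real^'d^'d. det A \<noteq> 0 \<and> L = range (\<lambda>z. A *v vec_of_int z)"
    using A B(4) group_closure_columns[of A] by auto
next
  assume "\<exists>A :: real^'d^'d. det A \<noteq> 0 \<and> L = range (\<lambda>z. A *v vec_of_int z)"
  then obtain A :: "real^'d^'d" where A: "det A \<noteq> 0" "L = range (\<lambda>z. A *v vec_of_int z)"
    by blast
  have "independent (columns A)"
    using det_dependent_columns A(1) dependent_vec_eq by blast
  moreover have "inj (\<lambda>s. column s A)"
    using A(1) det_identical_columns[of _ _ A] by (auto simp: inj_on_def)
  then have "card (columns A) = CARD('d)"
    by (simp add: columns_def full_SetCompr_eq card_image)
  moreover have "finite (columns A)"
    by (simp add: columns_def full_SetCompr_eq)
  ultimately show "lattice_of_rank CARD('d) L"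
    using A(2) group_closure_columns[of A] by (auto simp: lattice_of_rank_def)
qed

lemma span_lattice:
  fixes L :: "(real^'d) set"
  assumes "lattice_of_rank CARD('d) L"
  shows "span L = UNIV"
proof -
  obtain A :: "real^'d^'d" where A: "det A \<noteq> 0" "L = range (\<lambda>z. A *v vec_of_int z)"
    using assms by (auto simp: lattice_of_full_rank_iff)
  obtain A' where "A ** A' = mat 1"
    using A(1) invertible_det_nz invertible_right_inverse by metis
  then have "span (columns A) = UNIV"
    using matrix_right_invertible_span_columns[of A] by (auto simp: span_vec_eq)
  moreover have "columns A \<subseteq> L"
    using A(2) group_closure_columns[of A] group_closure.base by blast
  ultimately show ?thesis
    using span_mono by blast
qed

text \<open>Among all \<open>d\<close>-tuples of independent vectors of the group, one of minimal \<open>|det|\<close> is a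
  basis. Denominators bounded by \<open>N\<close> make \<open>N\<^sup>d |det|\<close> a natural number, so that a minimum
  exists; and if some \<open>h\<close> had a non-integral coordinate, then replacing the corresponding
  basis vector by \<open>h\<close> reduced modulo the basis would, by Cramer's rule, multiply the
  determinant by a number strictly between 0 and 1.\<close>

lemma lattice_of_rank_if_bounded_denominators:
  fixes H :: "(real^'d) set"
  assumes zero: "0 \<in> H" and diff: "\<And>v w. v \<in> H \<Longrightarrow> w \<in> H \<Longrightarrow> v - w \<in> H"
    and span: "span H = UNIV"
    and N: "N > 0" and den: "\<And>v s. v \<in> H \<Longrightarrow> of_nat N * v $ s \<in> \<int>"
  shows "lattice_of_rank CARD('d) H"
proof -
  define P where "P A \<longleftrightarrow> columns A \<subseteq> H \<and> det A \<noteq> 0" for A :: "real^'d^'d"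
  define D where "D A = of_nat N ^ CARD('d) * det A" for A :: "real^'d^'d"
  define \<mu> where "\<mu> A = nat \<lfloor>\<bar>D A\<bar>\<rfloor>" for A
  have D_Ints: "D A \<in> \<int>" if "columns A \<subseteq> H" for A
  proof -
    have "column s A \<in> H" for s
      using that by (auto simp: columns_def)
    then have entry: "of_nat N * A $ i $ j \<in> \<int>" for i j
      using den[of "column j A" i] by (simp add: column_def)
    have "D A = (\<Sum>\<sigma>\<in>{\<sigma>. \<sigma> permutes (UNIV :: 'd set)}.
        of_int (sign \<sigma>) * (\<Prod>i\<in>UNIV. of_nat N * A $ i $ \<sigma> i))"
      by (simp add: D_def det_def sum_distrib_left prod.distrib mult_ac)
    also have "\<dots> \<in> \<int>"
      by (intro Ints_sum Ints_mult[OF Ints_of_int] Ints_prod entry)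
    finally show ?thesis .
  qed
  obtain B where B: "B \<subseteq> H" "independent B" "H \<subseteq> span B" "card B = dim H"
    using basis_exists by blast
  have "card B = CARD('d)"
    using B(4) span dim_span[of H] by simp
  moreover have "finite B" using B(2) by (rule finiteI_independent)
  ultimately obtain A0 :: "real^'d^'d" where A0: "columns A0 = B"
    using matrix_with_columns by blast
  have "span B = UNIV"
    using B(3) span by (metis span_mono span_span top.extremum_uniqueI)
  then have "P A0"
    using A0 B(1) det_nonzero_if_span_columns[of A0] by (simp add: P_def)
  then obtain A where A: "P A" and min: "\<And>A'. P A' \<Longrightarrow> \<mu> A \<le> \<mu> A'"
    using ex_has_least_nat[of P A0 \<mu>] by blast
  have det: "det A \<noteq> 0" and colH: "columns A \<subseteq> H" using A by (auto simp: P_def)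
  have "group_closure (columns A) \<subseteq> H"
    using colH zero diff by (rule group_closure_subset)
  then have sub: "A *v vec_of_int z \<in> H" for z
    using group_closure_columns[of A] by auto
  have "h \<in> range (\<lambda>z. A *v vec_of_int z)" if h: "h \<in> H" for h
  proof -
    define c where "c = matrix_inv A *v h"
    have c: "A *v c = h"
      using det by (simp add: c_def matrix_mult_inv_vector)
    define z :: "int^'d" where "z = (\<chi> s. \<lfloor>c $ s\<rfloor>)"
    define f where "f = c - vec_of_int z"
    have f: "f $ s = frac (c $ s)" for s
      by (simp add: f_def z_def vec_of_int_def frac_def)
    have Af: "A *v f \<in> H"
      using diff[OF h sub[of z]] c by (simp add: f_def matrix_vector_mult_diff_distrib)
    have "f $ k = 0" for k
    proof (rule ccontr)
      assume nz: "f $ k \<noteq> 0"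
      then have fk: "0 < f $ k" "f $ k < 1"
        using frac_ge_0[of "c $ k"] frac_lt_1[of "c $ k"] by (simp_all add: f less_le)
      define A' :: "real^'d^'d" where
        "A' = (\<chi> i j. if j = k then (A *v f) $ i else A $ i $ j)"
      have det': "det A' = f $ k * det A"
        unfolding A'_def by (rule cramer_lemma)
      have "column j A' = (if j = k then A *v f else column j A)" for j
        by (simp add: A'_def column_def vec_eq_iff)
      then have colH': "columns A' \<subseteq> H"
        using colH Af by (auto simp: columns_def)
      then have "P A'"
        using det det' fk by (simp add: P_def)
      then have "\<mu> A \<le> \<mu> A'" by (rule min)
      moreover have "\<bar>D A'\<bar> < \<bar>D A\<bar>"
        using det det' fk N by (simp add: D_def abs_mult)
      moreover have "\<bar>D A\<bar> \<in> \<int>" "\<bar>D A'\<bar> \<in> \<int>"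
        using D_Ints colH colH' by (auto intro: Ints_abs)
      ultimately show False
        unfolding \<mu>_def by (elim Ints_cases) (auto simp: nat_le_eq_zle)
    qed
    then have "c = vec_of_int z"
      by (simp add: f_def vec_eq_iff)
    then show ?thesis using c by auto
  qed
  then have "H = range (\<lambda>z. A *v vec_of_int z)"
    using sub by auto
  then show ?thesis
    using det by (auto simp: lattice_of_full_rank_iff)
qed

lemma rational_common_denominator:
  assumes "finite F" "F \<subseteq> (\<rat> :: real set)"
  obtains N :: nat where "N > 0" "\<And>r. r \<in> F \<Longrightarrow> of_nat N * r \<in> \<int>"
proof -
  have "\<exists>N>0. \<forall>r\<in>F. of_nat N * r \<in> \<int>"
    using assms
  proof (induction F)
    case empty
    show ?case by (auto intro: exI[of _ 1])
  next
    case (insert r F)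
    then obtain N where N: "N > 0" "\<forall>r\<in>F. of_nat N * r \<in> \<int>" by auto
    obtain a b where ab: "b > 0" "r = of_int a / of_int b"
      using insert.prems by (auto elim: Rats_cases')
    have "of_nat (N * nat b) * r = of_int (int N * a)"
      using ab by simp
    then have "of_nat (N * nat b) * r \<in> \<int>" by (metis Ints_of_int)
    moreover have "of_nat (N * nat b) * r' \<in> \<int>" if "r' \<in> F" for r'
    proof -
      have "of_nat (nat b) * (of_nat N * r') \<in> \<int>"
        using N(2) that by (blast intro: Ints_mult Ints_of_nat)
      then show ?thesis by (simp add: mult_ac)
    qed
    ultimately show ?case
      using N(1) ab(1) by (intro exI[of _ "N * nat b"]) auto
  qed
  then show thesis using that by blast
qed

section \<open>Strictly auxetic deformations from Thales spheres\<close>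

lemma group_graph_aut_group: "group (graph_aut_group G)"
proof -
  interpret B: group "BijGroup (sverts G)" by (rule group_BijGroup)
  have "subgroup (graph_aut G) (BijGroup (sverts G))"
  proof (rule B.subgroupI)
    show "graph_aut G \<subseteq> carrier (BijGroup (sverts G))"
      by (auto simp: graph_aut_def BijGroup_def)
    have "(\<lambda>v\<in>sverts G. v) \<in> graph_aut G"
      by (auto simp: graph_aut_def id_Bij)
    then show "graph_aut G \<noteq> {}" by blast
  next
    fix f assume f: "f \<in> graph_aut G"
    then have Bij: "f \<in> Bij (sverts G)"
      and aut: "\<And>u v. u \<in> sverts G \<Longrightarrow> v \<in> sverts G \<Longrightarrow>
        {f u, f v} \<in> sedges G \<longleftrightarrow> {u, v} \<in> sedges G"
      by (auto simp: graph_aut_def)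
    let ?g = "inv_into (sverts G) f"
    have f_g: "f (?g u) = u" "?g u \<in> sverts G" if "u \<in> sverts G" for u
      using Bij_inv_into_mem[OF Bij that] Bij that
      by (auto simp: Bij_def bij_betw_def intro: f_inv_into_f)
    have "{?g u, ?g v} \<in> sedges G \<longleftrightarrow> {u, v} \<in> sedges G"
      if "u \<in> sverts G" "v \<in> sverts G" for u v
      using aut[of "?g u" "?g v"] f_g that by simp
    then show "inv\<^bsub>BijGroup (sverts G)\<^esub> f \<in> graph_aut G"
      using Bij by (simp add: inv_BijGroup graph_aut_def restrict_inv_into_Bij)
  next
    fix f g assume fg: "f \<in> graph_aut G" "g \<in> graph_aut G"
    then have "g u \<in> sverts G" if "u \<in> sverts G" for u
      using that Bij_imp_funcset[of g "sverts G"] by (auto simp: graph_aut_def)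
    then show "f \<otimes>\<^bsub>BijGroup (sverts G)\<^esub> g \<in> graph_aut G"
      using fg by (simp add: graph_aut_def BijGroup_def compose_Bij compose_eq)
  qed
  then have "group ((BijGroup (sverts G))\<lparr>carrier := graph_aut G\<rparr>)"
    by (rule B.subgroup_imp_group)
  then show ?thesis by (simp add: graph_aut_group_def)
qed

lemma vertex_orbit_eq: "vertex_orbit G \<Gamma> v = (\<lambda>\<gamma>. \<gamma> v) ` \<Gamma>"
  by (auto simp: vertex_orbit_def orbit_def period_group_def)

lemma gram_matrix_inner: "inner (gram_matrix A *v x) y = inner (A *v x) (A *v y)"
proof -
  have "inner (gram_matrix A *v x) y = inner (transpose A *v (A *v x)) y"
    by (simp add: gram_matrix_def matrix_vector_mul_assoc)
  also have "\<dots> = inner (A *v x) (A *v y)"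
    by (simp add: dot_lmul_matrix)
  finally show ?thesis .
qed

text \<open>The images of the generators generate the lattice as a group, hence they span what the
  lattice spans, which is everything.\<close>

lemma det_lattice_matrix_nonzero:
  fixes p :: "'v \<Rightarrow> real^'d"
  assumes F: "periodic_framework G \<Gamma> p \<pi>" and g: "independent_generators G \<Gamma> g"
  shows "det (lattice_matrix \<pi> g) \<noteq> 0"
proof -
  let ?P = "period_group G \<Gamma>" and ?S = "span (columns (lattice_matrix \<pi> g))"
  have "subgroup \<Gamma> (graph_aut_group G)"
    using F by (simp add: periodic_framework_def periodic_graph_def)
  then interpret P: group ?P
    unfolding period_group_def by (rule group.subgroup_imp_group[OF group_graph_aut_group])
  have carrier: "carrier ?P = \<Gamma>" by (simp add: period_group_def)
  have mult: "\<pi> (\<gamma> \<otimes>\<^bsub>?P\<^esub> \<delta>) = \<pi> \<gamma> + \<pi> \<delta>" if "\<gamma> \<in> \<Gamma>" "\<delta> \<in> \<Gamma>" for \<gamma> \<delta>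
    using F that by (simp add: periodic_framework_def)
  have pi_one: "\<pi> \<one>\<^bsub>?P\<^esub> = 0"
    using mult[of "\<one>\<^bsub>?P\<^esub>" "\<one>\<^bsub>?P\<^esub>"] P.one_closed carrier by simp
  have neg: "\<pi> (inv\<^bsub>?P\<^esub> \<gamma>) = - \<pi> \<gamma>" if "\<gamma> \<in> \<Gamma>" for \<gamma>
    using mult[of \<gamma> "inv\<^bsub>?P\<^esub> \<gamma>"] pi_one P.inv_closed[of \<gamma>] P.r_inv[of \<gamma>] that carrier
    by (simp add: eq_neg_iff_add_eq_0 add.commute)
  have gen: "generate ?P (range g) = \<Gamma>" "range g \<subseteq> \<Gamma>"
    using g by (auto simp: independent_generators_def)
  have col: "\<pi> (g s) \<in> ?S" for s
  proof -
    have "\<pi> (g s) = column s (lattice_matrix \<pi> g)"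
      by (simp add: column_def lattice_matrix_def)
    then show ?thesis by (auto simp: columns_def intro: span_base)
  qed
  have "\<pi> \<gamma> \<in> ?S" if "\<gamma> \<in> generate ?P (range g)" for \<gamma>
    using that
  proof (induction rule: generate.induct)
    case one
    show ?case by (simp add: pi_one span_0)
  next
    case (incl h)
    then show ?case using col by auto
  next
    case (inv h)
    then obtain s where "h = g s" "g s \<in> \<Gamma>" using gen(2) by blast
    then show ?case using col neg by (simp add: span_neg)
  next
    case (eng h1 h2)
    then show ?case using mult gen(1) by (simp add: span_add)
  qed
  then have "\<pi> ` \<Gamma> \<subseteq> ?S" using gen(1) by blast
  then have "span (\<pi> ` \<Gamma>) \<subseteq> ?S"
    by (rule span_minimal) (rule subspace_span)
  moreover have "span (\<pi> ` \<Gamma>) = UNIV"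
    using F by (intro span_lattice) (simp add: periodic_framework_def)
  ultimately show ?thesis
    by (intro det_nonzero_if_span_columns) auto
qed

text \<open>The equation of a deformation reads
  \<open>\<langle>\<omega>' c, c\<rangle> + 2 \<langle>\<omega> (q'\<^sub>j - q'\<^sub>i), c\<rangle> = 0\<close> for an edge vector \<open>c\<close> in lattice coordinates. With
  \<open>\<omega>' = 2 \<omega>\<close> and \<open>\<Lambda> q'\<^sub>i = - \<xi>\<^sub>i\<close> it becomes twice the difference of the two sides of the
  hypothesis on the Cartesian edge vector \<open>\<Lambda> c\<close>. Geometrically, the lattice is inflated
  uniformly while the vertices move against the points \<open>\<xi>\<^sub>i\<close> just enough to keep all edge
  lengths to first order.\<close>

lemma strictly_auxetic_if_spherical:
  fixes p \<xi> :: "'v \<Rightarrow> real^'d"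
  assumes F: "periodic_framework G \<Gamma> p \<pi>"
    and inv: "\<And>\<gamma> v. \<gamma> \<in> \<Gamma> \<Longrightarrow> v \<in> sverts G \<Longrightarrow> \<xi> (\<gamma> v) = \<xi> v"
    and sph: "\<And>u w. {u, w} \<in> sedges G \<Longrightarrow>
      inner (p w - p u) (p w - p u) = inner (\<xi> w - \<xi> u) (p w - p u)"
  shows "has_strictly_auxetic_deformation G \<Gamma> p \<pi>"
  unfolding has_strictly_auxetic_deformation_def
proof (intro allI impI, elim conjE)
  fix g :: "'d \<Rightarrow> 'v \<Rightarrow> 'v" and n v
  assume g: "independent_generators G \<Gamma> g" and v: "orbit_representatives G \<Gamma> n v"
  define \<Lambda> where "\<Lambda> = lattice_matrix \<pi> g"
  have "det \<Lambda> \<noteq> 0"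
    unfolding \<Lambda>_def using F g by (rule det_lattice_matrix_nonzero)
  then have "invertible \<Lambda>" and \<Lambda>_inv: "\<And>y. \<Lambda> *v (matrix_inv \<Lambda> *v y) = y"
    by (simp_all add: invertible_det_nz matrix_mult_inv_vector)
  have \<Lambda>_0: "y = 0" if "\<Lambda> *v y = 0" for y
    using \<open>invertible \<Lambda>\<close> that
    by (metis invertible_left_inverse matrix_left_invertible_ker)
  \<comment> \<open>Subtracting \<open>\<xi>\<close> at the base vertex normalises \<open>q' 0 = 0\<close>; only differences matter.\<close>
  define q' where "q' i = matrix_inv \<Lambda> *v (\<xi> (v 0) - \<xi> (v i))" for i
  define \<omega>' where "\<omega>' = 2 *\<^sub>R gram_matrix \<Lambda>"
  have \<omega>': "inner (\<omega>' *v y) y = 2 * inner (\<Lambda> *v y) (\<Lambda> *v y)" for y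
    by (simp add: \<omega>'_def scaleR_matrix_vector_assoc[symmetric] gram_matrix_inner)
  have sym: "transpose \<omega>' = \<omega>'"
    by (simp add: \<omega>'_def gram_matrix_def transpose_scalar matrix_transpose_mul transpose_transpose)
  have \<Lambda>q': "\<Lambda> *v (q' j - q' i) = - (\<xi> (v j) - \<xi> (v i))" for i j
    by (simp add: q'_def matrix_vector_mult_diff_distrib[of \<Lambda>] \<Lambda>_inv)
  have "positive_definite \<omega>'"
    using sym \<Lambda>_0 by (auto simp: positive_definite_def \<omega>')
  moreover have "infinitesimal_deformation G \<Gamma> p \<pi> g n v q' \<omega>'"
    unfolding infinitesimal_deformation_def Let_def \<Lambda>_def[symmetric]
  proof (intro conjI allI impI ballI)
    show "q' 0 = 0" by (simp add: q'_def)
    show "transpose \<omega>' = \<omega>'" by (rule sym)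
  next
    fix i j w z
    assume ij: "i < n" "j < n" and w: "w \<in> vertex_orbit G \<Gamma> (v j)"
      and "{v i, w} \<in> sedges G \<and> p w - p (v i) = p (v j) + \<Lambda> *v vec_of_int z - p (v i)"
    then have edge: "{v i, w} \<in> sedges G"
      and z: "p w - p (v i) = p (v j) + \<Lambda> *v vec_of_int z - p (v i)"
      by simp_all
    define c where "c = lattice_coord \<Lambda> p v j + vec_of_int z - lattice_coord \<Lambda> p v i"
    have \<Lambda>c: "\<Lambda> *v c = p w - p (v i)"
      unfolding z by (simp add: c_def lattice_coord_def matrix_vector_mult_diff_distrib[of \<Lambda>]
          matrix_vector_right_distrib[of \<Lambda>] \<Lambda>_inv)
    have "v j \<in> sverts G" using v ij by (auto simp: orbit_representatives_def)
    then have \<xi>: "\<xi> w = \<xi> (v j)" using w inv by (auto simp: vertex_orbit_eq)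
    have "inner (\<omega>' *v c) c + 2 * inner (gram_matrix \<Lambda> *v (q' j - q' i)) c =
        2 * (inner (p w - p (v i)) (p w - p (v i)) - inner (\<xi> w - \<xi> (v i)) (p w - p (v i)))"
      unfolding gram_matrix_inner \<omega>' \<Lambda>c \<Lambda>q' \<xi> by (simp add: algebra_simps)
    also have "\<dots> = 0" using sph[OF edge] by simp
    finally show "inner (\<omega>' *v (lattice_coord \<Lambda> p v j + vec_of_int z - lattice_coord \<Lambda> p v i))
          (lattice_coord \<Lambda> p v j + vec_of_int z - lattice_coord \<Lambda> p v i) +
        2 * inner (gram_matrix \<Lambda> *v (q' j - q' i))
          (lattice_coord \<Lambda> p v j + vec_of_int z - lattice_coord \<Lambda> p v i) = 0"
      unfolding c_def .
  qed
  ultimately show "\<exists>q' \<omega>'. infinitesimal_deformation G \<Gamma> p \<pi> g n v q' \<omega>' \<and> positive_definite \<omega>'"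
    by blast
qed

text \<open>Thales: the diameter is seen from \<open>x + w\<close> under a right angle, so that \<open>w\<close> is orthogonal
  to \<open>w - (y - x)\<close>.\<close>

lemma thales_sphere:
  fixes x y w :: "real^'d"
  assumes "x + w \<in> sphere (midpoint x y) (dist x y / 2)"
  shows "inner w w = inner (y - x) w"
proof -
  define D where "D = y - x"
  have "midpoint x y - (x + w) = (1/2) *\<^sub>R D - w"
    by (simp add: midpoint_def D_def algebra_simps vec_eq_iff)
  then have "norm ((1/2) *\<^sub>R D - w) = norm ((1/2) *\<^sub>R D)"
    using assms by (simp only: mem_sphere dist_norm) (simp add: norm_minus_commute D_def)
  then have "inner ((1/2) *\<^sub>R D - w) ((1/2) *\<^sub>R D - w) = inner ((1/2) *\<^sub>R D) ((1/2) *\<^sub>R D)"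
    by (metis power2_norm_eq_inner)
  then show ?thesis
    unfolding D_def[symmetric]
    by (simp add: inner_diff_left inner_diff_right inner_commute)
qed

section \<open>Walks in a multigraph with prescribed edge vectors\<close>

locale edge_vector_graph =
  fixes M :: "('v::linorder, 'e) multigraph"
    and e :: "'v \<Rightarrow> 'v \<Rightarrow> nat \<Rightarrow> real^'d"
  assumes multigraph: "multigraph M" and finite_multigraph: "finite_multigraph M"
    and loopless: "loopless M" and connected: "connected_graph (reduced_graph M)"
    and inj_e: "{i, j} \<in> sedges (reduced_graph M) \<Longrightarrow> inj_on (e i j) {1..multiplicity_of M i j}"
    and e_reverse: "{i, j} \<in> sedges (reduced_graph M) \<Longrightarrow> k \<in> {1..multiplicity_of M i j} \<Longrightarrow>
      e j i k = - e i j k"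
begin

abbreviation adj :: "'v \<Rightarrow> 'v \<Rightarrow> bool" where
  "adj i j \<equiv> {i, j} \<in> sedges (reduced_graph M)"

text \<open>Empty unless \<open>i\<close> and \<open>j\<close> are adjacent, so that membership in \<open>vecs i j\<close> also says that
  there is an edge.\<close>

definition vecs :: "'v \<Rightarrow> 'v \<Rightarrow> (real^'d) set" where
  "vecs i j = e i j ` {1..multiplicity_of M i j}"

abbreviation period_lattice :: "(real^'d) set" where
  "period_lattice \<equiv> group_closure (periodicity_vectors M e)"

lemma finite_verts: "finite (mverts M)" and finite_edges: "finite (medges M)"
  using finite_multigraph by (auto simp: finite_multigraph_def)

lemma edge_ends:
  assumes "a \<in> medges M"
  shows "mends M a \<subseteq> mverts M" "card (mends M a) = 2"
  using multigraph loopless assms by (auto simp: multigraph_def loopless_def)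

lemma adj_iff: "adj i j \<longleftrightarrow> (\<exists>a\<in>medges M. mends M a = {i, j})"
  by (auto simp: reduced_graph_def)

lemma adj_verts:
  assumes "adj i j"
  shows "i \<noteq> j" "i \<in> mverts M" "j \<in> mverts M"
proof -
  obtain a where a: "a \<in> medges M" "mends M a = {i, j}"
    using assms adj_iff by blast
  show "i \<noteq> j" using edge_ends(2)[OF a(1)] a(2) by auto
  show "i \<in> mverts M" "j \<in> mverts M" using edge_ends(1)[OF a(1)] a(2) by auto
qed

lemma multiplicity_commute: "multiplicity_of M i j = multiplicity_of M j i"
  by (simp add: multiplicity_of_def insert_commute)

lemma multiplicity_pos_iff: "0 < multiplicity_of M i j \<longleftrightarrow> adj i j"
proof -
  have "finite {a \<in> medges M. mends M a = {i, j}}"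
    using finite_edges by simp
  then show ?thesis
    by (auto simp: multiplicity_of_def card_gt_0_iff adj_iff)
qed

lemma vecs_adj: "w \<in> vecs i j \<Longrightarrow> adj i j"
  using multiplicity_pos_iff[of i j] by (auto simp: vecs_def)

lemma vecs_nonempty: "adj i j \<Longrightarrow> \<exists>w. w \<in> vecs i j"
  using multiplicity_pos_iff[of i j] by (auto simp: vecs_def)

lemma vecs_reverse:
  assumes "w \<in> vecs i j"
  shows "- w \<in> vecs j i"
  using assms e_reverse[OF vecs_adj[OF assms]] multiplicity_commute[of i j]
  by (auto simp: vecs_def image_iff)

lemma vecs_diff_period:
  assumes "w \<in> vecs i j" "w' \<in> vecs i j"
  shows "w - w' \<in> period_lattice"
proof -
  obtain k l where "k \<in> {1..multiplicity_of M i j}" "w = e i j k"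
      "l \<in> {1..multiplicity_of M i j}" "w' = e i j l"
    using assms by (auto simp: vecs_def)
  then have "w - w' \<in> periodicity_vectors M e"
    unfolding periodicity_vectors_def using vecs_adj[OF assms(1)] by blast
  then show ?thesis by (simp add: group_closure.base)
qed

inductive walk :: "'v \<Rightarrow> 'v \<Rightarrow> real^'d \<Rightarrow> bool" where
  stay: "u \<in> mverts M \<Longrightarrow> walk u u 0"
| step: "w \<in> vecs u v \<Longrightarrow> walk v z s \<Longrightarrow> walk u z (w + s)"

lemma walk_verts: "walk u v s \<Longrightarrow> u \<in> mverts M \<and> v \<in> mverts M"
  by (induction rule: walk.induct) (auto dest: vecs_adj adj_verts)

lemma walk_edge: "w \<in> vecs u v \<Longrightarrow> walk u v w"
  using walk.step[OF _ walk.stay] vecs_adj adj_verts by fastforce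

lemma walk_trans: "walk u v s \<Longrightarrow> walk v z t \<Longrightarrow> walk u z (s + t)"
  by (induction rule: walk.induct) (auto simp: add.assoc intro: walk.step)

lemma walk_reverse: "walk u v s \<Longrightarrow> walk v u (- s)"
proof (induction rule: walk.induct)
  case (stay u)
  then show ?case using walk.stay by simp
next
  case (step w u v z s)
  then have "walk z u (- s + - w)"
    by (intro walk_trans[OF step.IH] walk_edge vecs_reverse)
  then show ?case by (simp add: add.commute)
qed

lemma walk_exists:
  assumes "u \<in> mverts M" "v \<in> mverts M"
  shows "\<exists>s. walk u v s"
proof -
  have "(u, v) \<in> {(a, b). adj a b}\<^sup>*"
    using connected assms by (auto simp: connected_graph_def reduced_graph_def)
  then show ?thesis
  proof (induction rule: converse_rtrancl_induct)
    case base
    show ?case using assms(2) walk.stay by blast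
  next
    case (step y z)
    then show ?case using vecs_nonempty walk.step by blast
  qed
qed

text \<open>The vertices are recorded so that a walk can be cut where it repeats one.\<close>

inductive path :: "'v list \<Rightarrow> real^'d \<Rightarrow> bool" where
  single: "u \<in> mverts M \<Longrightarrow> path [u] 0"
| Cons: "w \<in> vecs u v \<Longrightarrow> path (v # xs) s \<Longrightarrow> path (u # v # xs) (w + s)"

lemma path_nonempty: "path xs s \<Longrightarrow> xs \<noteq> []"
  by (auto elim: path.cases)

lemma path_split:
  "path (xs @ u # ys) s \<Longrightarrow> \<exists>s1 s2. path (xs @ [u]) s1 \<and> path (u # ys) s2 \<and> s = s1 + s2"
proof (induction xs arbitrary: s)
  case Nil
  then have "u \<in> mverts M" by cases (auto dest: vecs_adj adj_verts)
  then show ?case using Nil path.single by fastforce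
next
  case (Cons x xs)
  from Cons.prems obtain w t v zs where *: "xs @ u # ys = v # zs" "w \<in> vecs x v"
      "path (v # zs) t" "s = w + t"
    by cases (auto simp: Cons_eq_append_conv append_eq_Cons_conv)
  then obtain s1 s2 where s: "path (xs @ [u]) s1" "path (u # ys) s2" "t = s1 + s2"
    using Cons.IH[of t] by metis
  obtain zs' where zs': "xs @ [u] = v # zs'"
    using *(1) by (cases xs) auto
  have "path (x # xs @ [u]) (w + s1)"
    using path.Cons[OF *(2)] s(1) unfolding zs' by blast
  then show ?case
    using s *(4) by (metis add.assoc append_Cons)
qed

lemma path_edge_choice:
  "path xs s \<Longrightarrow> \<exists>\<kappa>. (\<forall>t<length xs - 1. adj (xs ! t) (xs ! Suc t) \<and>
       \<kappa> t \<in> {1..multiplicity_of M (xs ! t) (xs ! Suc t)}) \<and>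
     s = (\<Sum>t<length xs - 1. e (xs ! t) (xs ! Suc t) (\<kappa> t))"
proof (induction rule: path.induct)
  case (single u)
  show ?case by simp
next
  case (Cons w u v xs s)
  then obtain \<kappa> where \<kappa>: "\<forall>t<length xs. adj ((v # xs) ! t) (xs ! t) \<and>
       \<kappa> t \<in> {1..multiplicity_of M ((v # xs) ! t) (xs ! t)}"
     "s = (\<Sum>t<length xs. e ((v # xs) ! t) (xs ! t) (\<kappa> t))"
    by auto
  obtain k where k: "k \<in> {1..multiplicity_of M u v}" "w = e u v k"
    using Cons.hyps(1) by (auto simp: vecs_def)
  show ?case
  proof (rule exI[of _ "case_nat k \<kappa>"], intro conjI allI impI)
    fix t assume "t < length (u # v # xs) - 1"
    then show "adj ((u # v # xs) ! t) ((u # v # xs) ! Suc t)"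
      "case_nat k \<kappa> t \<in> {1..multiplicity_of M ((u # v # xs) ! t) ((u # v # xs) ! Suc t)}"
      using \<kappa>(1) k(1) vecs_adj[OF Cons.hyps(1)] by (cases t; simp)+
  next
    show "w + s = (\<Sum>t<length (u # v # xs) - 1.
        e ((u # v # xs) ! t) ((u # v # xs) ! Suc t) (case_nat k \<kappa> t))"
      using \<kappa>(2) k(2) by (simp add: sum.lessThan_Suc_shift del: sum.lessThan_Suc)
  qed
qed

text \<open>A simple path that is closed up by one edge is either a cycle or runs back and forth
  between two vertices; both give one of the generating periodicity vectors.\<close>

lemma closed_simple_path_period:
  assumes path: "path xs s" and dist: "distinct xs" and w: "w \<in> vecs (last xs) (hd xs)"
  shows "s + w \<in> period_lattice"
proof -
  have "xs \<noteq> []" using path by (rule path_nonempty)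
  have "last xs \<noteq> hd xs" using adj_verts(1)[OF vecs_adj[OF w]] .
  then have "length xs \<noteq> 1" by (auto simp: length_Suc_conv)
  moreover have "length xs \<noteq> 0" using \<open>xs \<noteq> []\<close> by simp
  ultimately consider "length xs = 2" | "3 \<le> length xs" by linarith
  then show ?thesis
  proof cases
    case 1
    then obtain u v where xs: "xs = [u, v]"
      by (auto simp: length_Suc_conv numeral_2_eq_2)
    have "s \<in> vecs u v"
      using path unfolding xs
    proof cases
      case (Cons w s)
      moreover from Cons(3) have "s = 0" by cases auto
      ultimately show ?thesis by simp
    qed
    moreover have "- w \<in> vecs u v"
      using w vecs_reverse[of w v u] by (simp add: xs)
    ultimately show ?thesis
      using vecs_diff_period[of s u v "- w"] by simp
  next
    case 2
    define m where "m = length xs - 1"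
    have len: "length xs = Suc m" using 2 by (simp add: m_def)
    have ends: "xs ! m = last xs" "xs ! 0 = hd xs"
      using \<open>xs \<noteq> []\<close> by (simp_all add: m_def last_conv_nth hd_conv_nth)
    obtain \<kappa> where \<kappa>: "\<forall>t<m. adj (xs ! t) (xs ! Suc t) \<and>
        \<kappa> t \<in> {1..multiplicity_of M (xs ! t) (xs ! Suc t)}"
      "s = (\<Sum>t<m. e (xs ! t) (xs ! Suc t) (\<kappa> t))"
      using path_edge_choice[OF path] by (auto simp: m_def)
    obtain k where k: "k \<in> {1..multiplicity_of M (last xs) (hd xs)}" "w = e (last xs) (hd xs) k"
      using w by (auto simp: vecs_def)
    have step: "adj (xs ! t) (xs ! (Suc t mod length xs)) \<and> (\<kappa>(m := k)) t \<in>
        {1..multiplicity_of M (xs ! t) (xs ! (Suc t mod length xs))}" if "t < length xs" for t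
      using that \<kappa>(1) k(1) vecs_adj[OF w] ends len by (cases "t = m") auto
    have "is_cycle (reduced_graph M) xs"
      using 2 dist step by (auto simp: is_cycle_def)
    moreover have "s + w = (\<Sum>t<length xs. e (xs ! t) (xs ! (Suc t mod length xs)) ((\<kappa>(m := k)) t))"
      using \<kappa>(2) k(2) ends len by simp
    ultimately have "s + w \<in> periodicity_vectors M e"
      using step unfolding periodicity_vectors_def by blast
    then show ?thesis by (simp add: group_closure.base)
  qed
qed

text \<open>Prepending an edge to a simple path either keeps it simple or closes up an initial
  part of it, which may then be dropped.\<close>

lemma walk_simple_path:
  "walk u v s \<Longrightarrow> \<exists>xs t. path xs t \<and> distinct xs \<and> hd xs = u \<and> last xs = v \<and>
     s - t \<in> period_lattice"
proof (induction rule: walk.induct)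
  case (stay u)
  then show ?case by (intro exI[of _ "[u]"] exI[of _ 0]) (simp add: path.single)
next
  case (step w u v z s)
  then obtain xs t where xs: "path xs t" "distinct xs" "hd xs = v" "last xs = z"
      "s - t \<in> period_lattice"
    by blast
  have "u \<noteq> v" using step.hyps(1) vecs_adj adj_verts(1) by blast
  have "xs \<noteq> []" using xs(1) by (rule path_nonempty)
  then obtain ys where ys: "xs = v # ys" using xs(3) by (cases xs) auto
  show ?case
  proof (cases "u \<in> set xs")
    case False
    have "path (u # xs) (w + t)"
      using path.Cons[OF step.hyps(1)] xs(1) unfolding ys by blast
    then show ?thesis
      using False xs \<open>xs \<noteq> []\<close> by (intro exI[of _ "u # xs"] exI[of _ "w + t"]) simp
  next
    case True
    then obtain as bs where split: "xs = as @ u # bs"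
      by (meson split_list)
    have "as \<noteq> []" using split ys \<open>u \<noteq> v\<close> by auto
    obtain t1 t2 where t: "path (as @ [u]) t1" "path (u # bs) t2" "t = t1 + t2"
      using path_split xs(1) unfolding split by blast
    have "hd (as @ [u]) = v" using \<open>as \<noteq> []\<close> xs(3) split by simp
    then have "t1 + w \<in> period_lattice"
      using closed_simple_path_period[OF t(1), of w] xs(2) step.hyps(1) split by simp
    then have "(t1 + w) + (s - t) \<in> period_lattice"
      using xs(5) by (rule group_closure_add)
    then have "w + s - t2 \<in> period_lattice"
      using t(3) by (simp add: algebra_simps)
    then show ?thesis
      using t(2) xs(2,4) split by (intro exI[of _ "u # bs"] exI[of _ t2]) auto
  qed
qed

lemma closed_walk_period:
  assumes "walk u u s"
  shows "s \<in> period_lattice"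
proof -
  obtain xs t where xs: "path xs t" "distinct xs" "hd xs = u" "last xs = u"
      "s - t \<in> period_lattice"
    using walk_simple_path[OF assms] by blast
  have "xs = [u]"
    using path_nonempty[OF xs(1)] xs(2-4) by (cases xs) (auto split: if_splits)
  then have "t = 0"
    using xs(1) by (auto elim: path.cases)
  then show ?thesis using xs(5) by simp
qed

lemma periodicity_vector_closed_walk:
  assumes "s \<in> periodicity_vectors M e"
  shows "\<exists>u. walk u u s"
proof -
  from assms consider
    (pair) i j k l where "s = e i j k - e i j l" "adj i j"
      "k \<in> {1..multiplicity_of M i j}" "l \<in> {1..multiplicity_of M i j}"
  | (cycle) c \<kappa> where "s = (\<Sum>t<length c. e (c ! t) (c ! (Suc t mod length c)) (\<kappa> t))"
      "is_cycle (reduced_graph M) c"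
      "\<forall>t<length c. \<kappa> t \<in> {1..multiplicity_of M (c ! t) (c ! (Suc t mod length c))}"
    unfolding periodicity_vectors_def by blast
  then show ?thesis
  proof cases
    case pair
    then have "e i j k \<in> vecs i j" "e i j l \<in> vecs i j"
      by (auto simp: vecs_def)
    then have "walk i i (e i j k + - e i j l)"
      by (intro walk_trans walk_edge walk_reverse)
    then show ?thesis using pair(1) by auto
  next
    case cycle
    let ?f = "\<lambda>t. e (c ! t) (c ! (Suc t mod length c)) (\<kappa> t)"
    have "0 < length c" using cycle(2) by (auto simp: is_cycle_def)
    have edge: "walk (c ! t) (c ! (Suc t mod length c)) (?f t)" if "t < length c" for t
      using cycle(3) that by (intro walk_edge) (simp add: vecs_def)
    have "walk (c ! 0) (c ! (t mod length c)) (\<Sum>t'<t. ?f t')" if "t \<le> length c" for t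
      using that
    proof (induction t)
      case 0
      have "c ! 0 \<in> mverts M" using edge[of 0] walk_verts \<open>0 < length c\<close> by blast
      then show ?case using walk.stay by simp
    next
      case (Suc t)
      then show ?case using walk_trans[OF Suc.IH, of _ "?f t"] edge[of t] by simp
    qed
    from this[of "length c"] show ?thesis using cycle(1) by auto
  qed
qed

text \<open>Conjugating by a walk from \<open>u\<close> to a closed walk elsewhere does not change the sum, since
  addition is commutative. Hence the periods seen from any vertex are the same.\<close>

lemma period_closed_walk:
  assumes "s \<in> period_lattice" and u: "u \<in> mverts M"
  shows "walk u u s"
  using assms(1)
proof induction
  case (base s)
  show ?case
  proof (cases "s = 0")
    case True
    then show ?thesis using walk.stay[OF u] by simp
  next
    case False
    then obtain v where v: "walk v v s"
      using base periodicity_vector_closed_walk by blast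
    then obtain a where a: "walk u v a"
      using walk_exists u walk_verts by blast
    have "walk u u (a + (s + - a))"
      by (intro walk_trans[OF a] walk_trans[OF v] walk_reverse[OF a])
    then show ?thesis by simp
  qed
next
  case (diff s t)
  then have "walk u u (s + - t)"
    by (intro walk_trans walk_reverse)
  then show ?case by simp
qed

end

section \<open>Unfolding the multigraph over the integer vectors\<close>

locale periodic_unfolding = edge_vector_graph M e
  for M :: "('v::linorder, 'e) multigraph" and e :: "'v \<Rightarrow> 'v \<Rightarrow> nat \<Rightarrow> real^'d" +
  fixes A :: "real^'d^'d" and r :: 'v
  assumes det_A: "det A \<noteq> 0" and r_vert: "r \<in> mverts M"
    and lattice_A: "period_lattice = range (\<lambda>z. A *v vec_of_int z)"
begin

definition lat :: "int^'d \<Rightarrow> real^'d" where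
  "lat z = A *v vec_of_int z"

text \<open>Placing \<open>i\<close> at the end of some walk from \<open>r\<close> makes every edge vector agree with the
  difference of the placed ends up to the sum of a closed walk at \<open>r\<close>, that is, up to the
  lattice.\<close>

definition pos :: "'v \<Rightarrow> real^'d" where
  "pos i = (SOME s. walk r i s)"

definition place :: "'v \<times> (int^'d) \<Rightarrow> real^'d" where
  "place u = pos (fst u) + lat (snd u)"

definition cover :: "('v \<times> (int^'d)) sgraph" where
  "cover = \<lparr>sverts = mverts M \<times> UNIV,
     sedges = {{u, w} | u w. place w - place u \<in> vecs (fst u) (fst w)}\<rparr>"

definition shift :: "int^'d \<Rightarrow> 'v \<times> (int^'d) \<Rightarrow> 'v \<times> (int^'d)" where
  "shift z = (\<lambda>u\<in>sverts cover. (fst u, snd u + z))"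

definition shifts :: "('v \<times> (int^'d) \<Rightarrow> 'v \<times> (int^'d)) set" where
  "shifts = range shift"

text \<open>Any vertex could be used to read off the translation vector.\<close>

definition shift_vec :: "('v \<times> (int^'d) \<Rightarrow> 'v \<times> (int^'d)) \<Rightarrow> real^'d" where
  "shift_vec \<gamma> = place (\<gamma> (r, 0)) - place (r, 0)"

lemma lat_simps [simp]: "lat 0 = 0" "lat (y + z) = lat y + lat z" "lat (y - z) = lat y - lat z"
  by (simp_all add: lat_def matrix_vector_right_distrib matrix_vector_mult_diff_distrib)

lemma lat_eq_iff [simp]: "lat y = lat z \<longleftrightarrow> y = z"
proof
  assume "lat y = lat z"
  then have "A *v vec_of_int (y - z) = 0"
    by (simp add: lat_def matrix_vector_mult_diff_distrib)
  moreover have "\<exists>A'. A' ** A = mat 1"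
    using det_A by (simp add: invertible_det_nz[symmetric] invertible_left_inverse)
  ultimately have "vec_of_int (y - z) = (0 :: real^'d)"
    unfolding matrix_left_invertible_ker by blast
  then show "y = z" by simp
qed simp

lemma period_lattice_lat: "s \<in> period_lattice \<longleftrightarrow> (\<exists>z. s = lat z)"
  by (auto simp: lattice_A lat_def)

lemma walk_pos: "i \<in> mverts M \<Longrightarrow> walk r i (pos i)"
  unfolding pos_def using walk_exists[OF r_vert] by (rule someI_ex)

lemma vecs_lat:
  assumes w: "w \<in> vecs i j"
  obtains z where "w = pos j + lat z - pos i"
proof -
  have "i \<in> mverts M" "j \<in> mverts M"
    using adj_verts[OF vecs_adj[OF w]] by simp_all
  then have "walk r r (pos i + (w + - pos j))"
    by (intro walk_trans[OF walk_pos] walk_trans[OF walk_edge[OF w]] walk_reverse walk_pos)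
  then obtain z where "pos i + (w + - pos j) = lat z"
    using closed_walk_period period_lattice_lat by blast
  then have "w = pos j + lat z - pos i" by (simp add: algebra_simps)
  then show thesis by (rule that)
qed

lemma sverts_cover: "sverts cover = mverts M \<times> UNIV"
  by (simp add: cover_def)

lemma sverts_cover_iff [simp]: "u \<in> sverts cover \<longleftrightarrow> fst u \<in> mverts M"
  by (simp add: sverts_cover mem_Times_iff)

lemma sedges_cover: "{u, w} \<in> sedges cover \<longleftrightarrow> place w - place u \<in> vecs (fst u) (fst w)"
proof
  assume "{u, w} \<in> sedges cover"
  then obtain u' w' where *: "{u, w} = {u', w'}" "place w' - place u' \<in> vecs (fst u') (fst w')"
    by (auto simp: cover_def)
  then show "place w - place u \<in> vecs (fst u) (fst w)"
    using vecs_reverse[OF *(2)] by (auto simp: doubleton_eq_iff)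
next
  assume "place w - place u \<in> vecs (fst u) (fst w)"
  then show "{u, w} \<in> sedges cover" by (auto simp: cover_def simp del: split_paired_Ex)
qed

lemma sedges_cover_verts:
  assumes "{u, w} \<in> sedges cover"
  shows "u \<in> sverts cover" "w \<in> sverts cover" "fst u \<noteq> fst w"
  using adj_verts[OF vecs_adj] assms by (auto simp: sedges_cover mem_Times_iff)

lemma shift_in_shifts [simp]: "shift z \<in> shifts"
  by (simp add: shifts_def)

lemma shiftsE:
  assumes "\<gamma> \<in> shifts"
  obtains z where "\<gamma> = shift z"
  using assms by (auto simp: shifts_def)

lemma shift_apply: "u \<in> sverts cover \<Longrightarrow> shift z u = (fst u, snd u + z)"
  by (simp add: shift_def)

lemma fst_shift [simp]: "fst u \<in> mverts M \<Longrightarrow> fst (shift z u) = fst u"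
  by (simp add: shift_apply)

lemma place_shift: "u \<in> sverts cover \<Longrightarrow> place (shift z u) = place u + lat z"
  by (simp add: shift_apply place_def)

lemma shift_shift: "u \<in> sverts cover \<Longrightarrow> shift z (shift y u) = shift (z + y) u"
  by (auto simp: shift_def mem_Times_iff add_ac)

lemma shift_0: "shift 0 = (\<lambda>u\<in>sverts cover. u)"
  by (simp add: shift_def fun_eq_iff)

lemma shift_Bij: "shift z \<in> Bij (sverts cover)"
proof -
  have "bij_betw (shift z) (sverts cover) (sverts cover)"
    by (rule bij_betw_byWitness[where f' = "shift (- z)"])
      (auto simp: shift_shift shift_0 simp del: split_paired_All)
  then show ?thesis by (simp add: Bij_def shift_def)
qed

lemma shift_aut: "shift z \<in> graph_aut cover"
  unfolding graph_aut_def by (simp add: shift_Bij sedges_cover place_shift)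

lemma shift_inject [simp]: "shift y = shift z \<longleftrightarrow> y = z"
proof
  assume "shift y = shift z"
  then have "shift y (r, 0) = shift z (r, 0)" by simp
  then show "y = z" using r_vert by (simp add: shift_apply)
qed simp

lemma shift_mult: "shift y \<otimes>\<^bsub>BijGroup (sverts cover)\<^esub> shift z = shift (y + z)"
  using shift_Bij by (auto simp: BijGroup_def compose_def shift_shift shift_def fun_eq_iff
      split: if_splits)

lemma shift_vec_shift [simp]: "shift_vec (shift z) = lat z"
  using r_vert by (simp add: shift_vec_def place_shift)

lemma period_group_simps [simp]:
  "carrier (period_group cover shifts) = shifts"
  "x \<otimes>\<^bsub>period_group cover shifts\<^esub> y = x \<otimes>\<^bsub>BijGroup (sverts cover)\<^esub> y"
  "\<one>\<^bsub>period_group cover shifts\<^esub> = shift 0"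
  by (simp_all add: period_group_def graph_aut_group_def shift_0) (simp add: BijGroup_def)

lemma subgroup_shifts: "subgroup shifts (graph_aut_group cover)"
proof (rule group.subgroupI[OF group_graph_aut_group])
  show "shifts \<subseteq> carrier (graph_aut_group cover)"
    using shift_aut by (auto simp: shifts_def graph_aut_group_def)
  show "shifts \<noteq> {}" by (simp add: shifts_def)
next
  fix \<gamma> assume "\<gamma> \<in> shifts"
  then obtain z where \<gamma>: "\<gamma> = shift z" by (auto simp: shifts_def)
  have "inv\<^bsub>graph_aut_group cover\<^esub> \<gamma> = shift (- z)"
  proof (rule group.inv_equality[OF group_graph_aut_group])
    show "shift (- z) \<otimes>\<^bsub>graph_aut_group cover\<^esub> \<gamma> = \<one>\<^bsub>graph_aut_group cover\<^esub>"
      using shift_mult[of "- z" z] shift_0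
      by (simp add: \<gamma> graph_aut_group_def) (simp add: BijGroup_def)
  qed (simp_all add: \<gamma> graph_aut_group_def shift_aut)
  then show "inv\<^bsub>graph_aut_group cover\<^esub> \<gamma> \<in> shifts" by (simp add: shifts_def)
next
  fix \<gamma> \<delta> assume "\<gamma> \<in> shifts" "\<delta> \<in> shifts"
  then show "\<gamma> \<otimes>\<^bsub>graph_aut_group cover\<^esub> \<delta> \<in> shifts"
    using shift_mult by (auto simp: shifts_def graph_aut_group_def)
qed

lemma period_group_free_Abelian:
  "period_group cover shifts \<cong> free_Abelian_group {..<CARD('d)}"
proof -
  obtain \<beta> where \<beta>: "bij_betw \<beta> (UNIV :: 'd set) {..<CARD('d)}"
    using finite_same_card_bij[of "UNIV :: 'd set" "{..<CARD('d)}"] by auto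
  define coords where "coords c = (\<chi> s. Poly_Mapping.lookup c (\<beta> s))" for c :: "nat \<Rightarrow>\<^sub>0 int"
  have coords_add: "coords (b + c) = coords b + coords c" for b c
    by (simp add: coords_def lookup_add vec_eq_iff)
  have "(\<lambda>c. shift (coords c)) \<in> hom (free_Abelian_group {..<CARD('d)}) (period_group cover shifts)"
    by (rule homI) (simp_all add: coords_add shift_mult)
  moreover have "inj_on (\<lambda>c. shift (coords c)) (carrier (free_Abelian_group {..<CARD('d)}))"
  proof (rule inj_onI)
    fix b c :: "nat \<Rightarrow>\<^sub>0 int"
    assume keys: "b \<in> carrier (free_Abelian_group {..<CARD('d)})"
        "c \<in> carrier (free_Abelian_group {..<CARD('d)})"
      and "shift (coords b) = shift (coords c)"
    then have eq: "Poly_Mapping.lookup b (\<beta> s) = Poly_Mapping.lookup c (\<beta> s)" for s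
      by (simp add: coords_def vec_eq_iff)
    show "b = c"
    proof (rule poly_mapping_eqI)
      fix k
      show "Poly_Mapping.lookup b k = Poly_Mapping.lookup c k"
      proof (cases "k < CARD('d)")
        case True
        then obtain s where "k = \<beta> s" using \<beta> by (auto simp: bij_betw_def)
        then show ?thesis using eq by simp
      next
        case False
        then have "k \<notin> Poly_Mapping.keys b" "k \<notin> Poly_Mapping.keys c"
          using keys by auto
        then show ?thesis by (simp add: in_keys_iff)
      qed
    qed
  qed
  moreover have "shift z \<in> (\<lambda>c. shift (coords c)) ` carrier (free_Abelian_group {..<CARD('d)})" for z
  proof -
    define f where "f k = (if k < CARD('d) then z $ inv_into UNIV \<beta> k else 0)" for k
    have "finite {k. f k \<noteq> 0}"
      by (rule finite_subset[of _ "{..<CARD('d)}"]) (auto simp: f_def)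
    then have lookup: "Poly_Mapping.lookup (Abs_poly_mapping f) = f"
      by simp
    have "\<beta> s < CARD('d)" "inv_into UNIV \<beta> (\<beta> s) = s" for s
      using \<beta> by (auto simp: bij_betw_def)
    then have "coords (Abs_poly_mapping f) = z"
      by (simp add: coords_def lookup f_def vec_eq_iff)
    moreover have "Abs_poly_mapping f \<in> carrier (free_Abelian_group {..<CARD('d)})"
      by (auto simp: in_keys_iff lookup f_def split: if_splits)
    ultimately show ?thesis by (metis imageI)
  qed
  then have "carrier (period_group cover shifts) \<subseteq>
      (\<lambda>c. shift (coords c)) ` carrier (free_Abelian_group {..<CARD('d)})"
    by (auto elim!: shiftsE simp del: carrier_free_Abelian_group_iff)
  ultimately have "(\<lambda>c. shift (coords c)) \<in>
      iso (free_Abelian_group {..<CARD('d)}) (period_group cover shifts)"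
    by (auto simp: iso_iff_mon_epi mon_def epi_iff_subset)
  then show ?thesis
    by (meson group.iso_sym group_free_Abelian_group is_iso_def empty_iff is_isoI)
qed

text \<open>Walks of the multigraph lift to the cover, and the lift ends at the vertex determined by
  the sum. Since every lattice vector is the sum of a closed walk, every vertex is reached.\<close>

lemma connected_cover: "connected_graph cover"
proof -
  \<comment> \<open>A vertex of the cover is determined by its image in the multigraph and its place, so it
    suffices to prescribe the sum.\<close>
  have lift: "place b - place a = s \<Longrightarrow> fst a = i \<Longrightarrow> fst b = j \<Longrightarrow>
      (a, b) \<in> {(a, b). {a, b} \<in> sedges cover}\<^sup>*" if "walk i j s" for i j s a b
    using that
  proof (induction arbitrary: a rule: walk.induct)
    case (stay u)
    then have "a = b" by (simp add: place_def prod_eq_iff)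
    then show ?case by simp
  next
    case (step w i k j s)
    obtain z where z: "w = pos k + lat z - pos i"
      using vecs_lat[OF step.hyps(1)] .
    let ?c = "(k, snd a + z)"
    have place: "place ?c - place a = w"
      using step.prems(2) z by (simp add: place_def algebra_simps)
    then have "{a, ?c} \<in> sedges cover"
      using step.hyps(1) step.prems(2) by (simp add: sedges_cover)
    moreover have "(?c, b) \<in> {(a, b). {a, b} \<in> sedges cover}\<^sup>*"
      using step.prems place by (intro step.IH) (auto simp: algebra_simps)
    ultimately show ?case
      by (simp add: converse_rtrancl_into_rtrancl)
  qed
  have "(a, b) \<in> {(a, b). {a, b} \<in> sedges cover}\<^sup>*"
    if "a \<in> sverts cover" "b \<in> sverts cover" for a b
  proof -
    have i: "fst a \<in> mverts M" "fst b \<in> mverts M" using that by simp_all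
    have "walk (fst b) (fst b) (lat (snd b - snd a))"
      using i(2) by (intro period_closed_walk) (auto simp: period_lattice_lat simp del: lat_simps)
    then have "walk (fst a) (fst b) (- pos (fst a) + (pos (fst b) + lat (snd b - snd a)))"
      using walk_trans[OF walk_reverse[OF walk_pos[OF i(1)]] walk_trans[OF walk_pos[OF i(2)]]]
      by blast
    then show ?thesis
      by (rule lift) (simp_all add: place_def)
  qed
  moreover have "(r, 0) \<in> sverts cover" using r_vert by simp
  ultimately show ?thesis
    unfolding connected_graph_def by blast
qed

lemma finite_degree: "finite {w. {u, w} \<in> sedges cover}"
proof -
  let ?W = "SIGMA j:mverts M. vecs (fst u) j"
  have "finite ?W"
    using finite_verts by (auto simp: vecs_def)
  moreover have "inj_on (\<lambda>w. (fst w, place w - place u)) {w. {u, w} \<in> sedges cover}"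
    by (auto simp: inj_on_def place_def prod_eq_iff)
  moreover have "(\<lambda>w. (fst w, place w - place u)) ` {w. {u, w} \<in> sedges cover} \<subseteq> ?W"
    using sedges_cover_verts(2)[of u] by (auto simp: sedges_cover mem_Times_iff)
  ultimately show ?thesis
    by (meson inj_on_finite)
qed

lemma vertex_orbit_cover:
  assumes "u \<in> sverts cover"
  shows "vertex_orbit cover shifts u = {fst u} \<times> UNIV"
proof -
  have "(fst u, z) \<in> (\<lambda>\<gamma>. \<gamma> u) ` shifts" for z
    by (rule image_eqI[of _ _ "shift (z - snd u)"]) (use assms in \<open>auto simp: shift_apply shifts_def\<close>)
  then show ?thesis
    using assms by (auto simp: vertex_orbit_eq shifts_def shift_apply)
qed

lemma vertex_orbits_cover: "vertex_orbits cover shifts = (\<lambda>i. {i} \<times> UNIV) ` mverts M"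
proof -
  have "vertex_orbits cover shifts = vertex_orbit cover shifts ` sverts cover"
    by (auto simp: vertex_orbits_def vertex_orbit_def orbits_def)
  also have "\<dots> = (\<lambda>u. {fst u} \<times> UNIV) ` sverts cover"
    by (rule image_cong) (simp_all add: vertex_orbit_cover)
  also have "\<dots> = (\<lambda>i. {i} \<times> UNIV) ` fst ` sverts cover"
    by (simp only: image_image)
  finally show ?thesis by (simp add: sverts_cover)
qed

lemma infinite_UNIV_int_vec: "infinite (UNIV :: (int^'d) set)"
proof
  assume "finite (UNIV :: (int^'d) set)"
  then have "finite (range (\<lambda>k::int. (\<chi> s. k) :: int^'d))"
    by (rule finite_subset[rotated]) simp
  moreover have "inj (\<lambda>k::int. (\<chi> s. k) :: int^'d)"
    by (simp add: inj_on_def vec_eq_iff)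
  ultimately show False
    using finite_imageD infinite_UNIV_int by blast
qed

lemma periodic_graph_cover: "periodic_graph CARD('d) cover shifts"
proof -
  have "simple_graph cover"
    unfolding simple_graph_def
  proof
    fix X assume X: "X \<in> sedges cover"
    then obtain u w where [simp]: "X = {u, w}" by (auto simp: cover_def)
    show "X \<subseteq> sverts cover \<and> card X = 2"
      using sedges_cover_verts[of u w] X by (cases "u = w") simp_all
  qed
  moreover have "infinite (sverts cover)"
    using infinite_UNIV_int_vec r_vert by (auto simp: sverts_cover dest: finite_cartesian_productD2)
  moreover have "finite (vertex_orbits cover shifts)"
    using finite_verts by (simp add: vertex_orbits_cover)
  moreover have "\<gamma> = \<one>\<^bsub>period_group cover shifts\<^esub>"
    if "\<gamma> \<in> shifts" "v \<in> sverts cover" "\<gamma> v = v" for \<gamma> v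
    using that by (auto elim!: shiftsE simp: shift_apply prod_eq_iff)
  ultimately show ?thesis
    unfolding periodic_graph_def
    using connected_cover finite_degree subgroup_shifts period_group_free_Abelian by blast
qed

lemma periodic_framework_cover:
  "periodic_framework cover shifts place shift_vec"
  "shift_vec ` shifts = period_lattice"
proof -
  show L: "shift_vec ` shifts = period_lattice"
    by (auto simp: shifts_def image_image lattice_A lat_def)
  show "periodic_framework cover shifts place shift_vec"
    unfolding periodic_framework_def L
  proof (intro conjI ballI)
    show "periodic_graph CARD('d) cover shifts" by (rule periodic_graph_cover)
    show "inj_on shift_vec shifts" by (auto simp: inj_on_def shifts_def)
    show "lattice_of_rank CARD('d) period_lattice"
      using det_A lattice_A by (auto simp: lattice_of_full_rank_iff)
  qed (auto elim!: shiftsE simp: shift_mult place_shift)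
qed

lemma edge_vectors_cover:
  assumes "i \<in> mverts M" "j \<in> mverts M"
  shows "edge_vectors_between cover place ({i} \<times> UNIV) ({j} \<times> UNIV) = vecs i j"
proof
  show "edge_vectors_between cover place ({i} \<times> UNIV) ({j} \<times> UNIV) \<subseteq> vecs i j"
    by (auto simp: edge_vectors_between_def sedges_cover)
  show "vecs i j \<subseteq> edge_vectors_between cover place ({i} \<times> UNIV) ({j} \<times> UNIV)"
  proof
    fix w assume w: "w \<in> vecs i j"
    obtain z where "w = pos j + lat z - pos i"
      using vecs_lat[OF w] .
    then have "w = place (j, z) - place (i, 0)"
      by (simp add: place_def algebra_simps)
    then show "w \<in> edge_vectors_between cover place ({i} \<times> UNIV) ({j} \<times> UNIV)"
      using w by (force simp: edge_vectors_between_def sedges_cover)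
  qed
qed

lemma edge_numbering:
  obtains \<kappa> where "\<And>i j. bij_betw \<kappa> {a \<in> medges M. mends M a = {i, j}} {1..multiplicity_of M i j}"
proof -
  have "\<exists>f. bij_betw f {a \<in> medges M. mends M a = X} {1..card {a \<in> medges M. mends M a = X}}" for X
    using ex_bij_betw_nat_finite_1[of "{a \<in> medges M. mends M a = X}"] finite_edges bij_betw_inv
    by fastforce
  then obtain f where f: "\<And>X. bij_betw (f X) {a \<in> medges M. mends M a = X}
      {1..card {a \<in> medges M. mends M a = X}}"
    by metis
  show thesis
  proof (rule that[of "\<lambda>a. f (mends M a) a"])
    fix i j
    show "bij_betw (\<lambda>a. f (mends M a) a) {a \<in> medges M. mends M a = {i, j}} {1..multiplicity_of M i j}"
      using f[of "{i, j}"] unfolding multiplicity_of_def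
      by (rule iffD1[OF bij_betw_cong, rotated]) simp
  qed
qed

text \<open>Each edge of the multigraph receives one of the vectors of its pair of ends, and its orbit
  consists of the edges of the cover over these ends that have this vector. The linear order on the vertices
  orients the edges; otherwise each orbit would carry two vectors, \<open>e i j k\<close> and \<open>e j i k\<close>.
  Distinct vectors give distinct orbits, so that multiplicities are preserved.\<close>

lemma edge_orbits_cover:
  obtains fibre where
    "bij_betw fibre (medges M) (edge_orbits cover shifts)"
    "\<And>a. a \<in> medges M \<Longrightarrow> fst ` \<Union>(fibre a) = mends M a"
proof -
  obtain \<kappa> where \<kappa>: "\<And>i j. bij_betw \<kappa> {a \<in> medges M. mends M a = {i, j}} {1..multiplicity_of M i j}"
    using edge_numbering by metis
  define src where "src a = Min (mends M a)" for a
  define tgt where "tgt a = Max (mends M a)" for a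
  define gain where "gain a = e (src a) (tgt a) (\<kappa> a)" for a
  define lifts where "lifts a u w \<longleftrightarrow> fst u = src a \<and> fst w = tgt a \<and> place w - place u = gain a" for a u w
  define fibre where "fibre a = {{u, w} | u w. lifts a u w}" for a
  have src_tgt: "src a = i" "tgt a = j" if "mends M a = {i, j}" "i < j" for a i j
    using that by (simp_all add: src_def tgt_def)
  have ends: "mends M a = {src a, tgt a}" "src a < tgt a" if a: "a \<in> medges M" for a
  proof -
    obtain i j where ij: "mends M a = {i, j}" "i < j"
      using edge_ends(2)[OF a] by (metis card_2_iff insert_commute linorder_less_linear)
    then show "mends M a = {src a, tgt a}" "src a < tgt a"
      using src_tgt[OF ij] by simp_all
  qed
  have gain: "gain a \<in> vecs (src a) (tgt a)" if "a \<in> medges M" for a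
    using bij_betwE[OF \<kappa>[of "src a" "tgt a"]] that ends[OF that] by (simp add: gain_def vecs_def)
  have lifts_ex: "\<exists>u w. lifts a u w" if a: "a \<in> medges M" for a
  proof -
    obtain z where "gain a = pos (tgt a) + lat z - pos (src a)"
      using vecs_lat[OF gain[OF a]] .
    then have "lifts a (src a, 0) (tgt a, z)"
      by (simp add: lifts_def place_def)
    then show ?thesis by blast
  qed
  have edge: "{u, w} \<in> sedges cover" if "a \<in> medges M" "lifts a u w" for a u w
    using that gain by (simp add: sedges_cover lifts_def)
  have edge_lifts: "\<exists>a\<in>medges M. lifts a u w" if uw: "{u, w} \<in> sedges cover" "fst u < fst w" for u w
  proof -
    obtain k where k: "k \<in> {1..multiplicity_of M (fst u) (fst w)}"
        "place w - place u = e (fst u) (fst w) k"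
      using uw(1) by (auto simp: sedges_cover vecs_def)
    then have "k \<in> \<kappa> ` {a \<in> medges M. mends M a = {fst u, fst w}}"
      using bij_betw_imp_surj_on[OF \<kappa>[of "fst u" "fst w"]] by simp
    then obtain a where a: "a \<in> medges M" "mends M a = {fst u, fst w}" "\<kappa> a = k"
      by blast
    then have "lifts a u w"
      using k(2) src_tgt[OF a(2) uw(2)] by (simp add: lifts_def gain_def)
    then show ?thesis using a(1) by blast
  qed
  have fibreI: "{u, w} \<in> fibre a" if "lifts a u w" for a u w
    using that unfolding fibre_def by blast
  have fibreE: "\<exists>u w. X = {u, w} \<and> lifts a u w" if "X \<in> fibre a" for X a
    using that unfolding fibre_def by blast
  have orbit: "orbit (period_group cover shifts) (\<lambda>\<gamma> X. \<gamma> ` X) {u, w} = fibre a"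
    if a: "a \<in> medges M" and uw: "lifts a u w" for a u w
  proof -
    have verts: "fst u \<in> mverts M" "fst w \<in> mverts M"
      using sedges_cover_verts[OF edge[OF a uw]] by simp_all
    show ?thesis
    proof
      have "{shift z u, shift z w} \<in> fibre a" for z
      proof -
        have "lifts a (shift z u) (shift z w)"
          using uw verts by (simp add: lifts_def place_shift)
        then show ?thesis by (rule fibreI)
      qed
      then show "orbit (period_group cover shifts) (\<lambda>\<gamma> X. \<gamma> ` X) {u, w} \<subseteq> fibre a"
        by (auto simp: orbit_def elim!: shiftsE)
    next
      show "fibre a \<subseteq> orbit (period_group cover shifts) (\<lambda>\<gamma> X. \<gamma> ` X) {u, w}"
      proof
        fix X assume "X \<in> fibre a"
        then obtain u' w' where X: "X = {u', w'}" "lifts a u' w'"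
          using fibreE by blast
        define z where "z = snd u' - snd u"
        have "lat (snd w') = place w' - pos (tgt a)" "lat (snd w) = place w - pos (tgt a)"
          "lat (snd u') = place u' - pos (src a)" "lat (snd u) = place u - pos (src a)"
          using uw X(2) by (simp_all add: lifts_def place_def)
        moreover have "place w' = place u' + gain a" "place w = place u + gain a"
          using uw X(2) by (simp_all add: lifts_def diff_eq_eq add.commute)
        ultimately have "lat (snd w') = lat (snd w + z)"
          by (simp add: z_def)
        then have "snd w' = snd w + z" unfolding lat_eq_iff .
        then have "shift z u = u'" "shift z w = w'"
          using uw X(2) verts by (simp_all add: shift_apply lifts_def prod_eq_iff z_def)
        then have "X = shift z ` {u, w}" using X(1) by simp
        then show "X \<in> orbit (period_group cover shifts) (\<lambda>\<gamma> X. \<gamma> ` X) {u, w}"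
          unfolding orbit_def by (intro CollectI exI[of _ "shift z"]) simp
      qed
    qed
  qed
  have "inj_on fibre (medges M)"
  proof (rule inj_onI)
    fix a b assume a: "a \<in> medges M" and b: "b \<in> medges M" and eq: "fibre a = fibre b"
    obtain u w where uw: "lifts a u w" using lifts_ex[OF a] by blast
    then have "{u, w} \<in> fibre b" using eq fibreI by blast
    then obtain u' w' where u'w': "{u, w} = {u', w'}" "lifts b u' w'"
      using fibreE by blast
    have "u = u' \<and> w = w'"
    proof (rule ccontr)
      assume "\<not> (u = u' \<and> w = w')"
      then have "u = w'" "w = u'" using u'w'(1) by (auto simp: doubleton_eq_iff)
      then have "src a = tgt b" "tgt a = src b"
        using uw u'w'(2) by (simp_all add: lifts_def)
      then show False using ends(2)[OF a] ends(2)[OF b] by simp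
    qed
    then have same: "src a = src b" "tgt a = tgt b" "gain a = gain b"
      using uw u'w'(2) by (simp_all add: lifts_def)
    let ?S = "{c \<in> medges M. mends M c = {src b, tgt b}}"
    have S: "a \<in> ?S" "b \<in> ?S" using a b ends(1) same by auto
    have "adj (src b) (tgt b)" using gain[OF b] by (rule vecs_adj)
    then have "\<kappa> a = \<kappa> b"
      using S same bij_betwE[OF \<kappa>[of "src b" "tgt b"]]
      by (intro inj_onD[OF inj_e[of "src b" "tgt b"]]) (simp_all add: gain_def)
    then show "a = b"
      using S by (intro inj_onD[OF bij_betw_imp_inj_on[OF \<kappa>[of "src b" "tgt b"]]])
  qed
  moreover have "fibre ` medges M = edge_orbits cover shifts"
  proof
    show "fibre ` medges M \<subseteq> edge_orbits cover shifts"
    proof clarify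
      fix a assume a: "a \<in> medges M"
      obtain u w where "lifts a u w" using lifts_ex[OF a] by blast
      then show "fibre a \<in> edge_orbits cover shifts"
        using orbit[OF a] edge[OF a] unfolding edge_orbits_def orbits_def by blast
    qed
    show "edge_orbits cover shifts \<subseteq> fibre ` medges M"
    proof
      fix \<epsilon> assume "\<epsilon> \<in> edge_orbits cover shifts"
      then obtain X where X: "X \<in> sedges cover"
          "\<epsilon> = orbit (period_group cover shifts) (\<lambda>\<gamma> X. \<gamma> ` X) X"
        by (auto simp: edge_orbits_def orbits_def)
      obtain u0 w0 where X0: "X = {u0, w0}" using X(1) by (auto simp: cover_def)
      have "fst u0 \<noteq> fst w0" using sedges_cover_verts(3) X(1) unfolding X0 .
      then consider "fst u0 < fst w0" | "fst w0 < fst u0" using neq_iff by blast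
      then obtain u w where uw: "X = {u, w}" "fst u < fst w"
      proof cases
        case 1
        then show ?thesis using X0 by (intro that[of u0 w0])
      next
        case 2
        then show ?thesis using X0 by (intro that[of w0 u0]) (simp_all add: insert_commute)
      qed
      then obtain a where "a \<in> medges M" "lifts a u w"
        using edge_lifts X(1) by blast
      then show "\<epsilon> \<in> fibre ` medges M"
        using orbit X(2) uw(1) by blast
    qed
  qed
  ultimately have "bij_betw fibre (medges M) (edge_orbits cover shifts)"
    by (rule bij_betw_imageI)
  moreover have "fst ` \<Union>(fibre a) = mends M a" if a: "a \<in> medges M" for a
  proof -
    obtain u w where uw: "lifts a u w" using lifts_ex[OF a] by blast
    then have "{fst u, fst w} \<subseteq> fst ` \<Union>(fibre a)"
      using fibreI[OF uw] by blast
    then have "{src a, tgt a} \<subseteq> fst ` \<Union>(fibre a)"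
      using uw by (simp add: lifts_def)
    moreover have "fst v \<in> {src a, tgt a}" if "X \<in> fibre a" "v \<in> X" for X v
      using fibreE[OF that(1)] that(2) by (auto simp: lifts_def)
    then have "fst ` \<Union>(fibre a) \<subseteq> {src a, tgt a}" by blast
    ultimately show ?thesis using ends(1)[OF a] by (simp only: subset_antisym)
  qed
  ultimately show thesis by (rule that)
qed

lemma quotient_cover:
  "\<exists>f h. multigraph_iso f h (quotient_multigraph cover shifts) M \<and>
     (\<forall>i\<in>mverts M. f ({i} \<times> UNIV) = i)"
proof -
  obtain fibre where bij: "bij_betw fibre (medges M) (edge_orbits cover shifts)"
    and ends: "\<And>a. a \<in> medges M \<Longrightarrow> fst ` \<Union>(fibre a) = mends M a"
    using edge_orbits_cover by blast
  define f :: "('v \<times> (int^'d)) set \<Rightarrow> 'v" where "f B = the_elem (fst ` B)" for B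
  let ?h = "inv_into (medges M) fibre"
  have f: "f ({i} \<times> UNIV) = i" for i
    by (simp add: f_def)
  have "bij_betw f (vertex_orbits cover shifts) (mverts M)"
    unfolding vertex_orbits_cover
    by (rule bij_betw_byWitness[where f' = "\<lambda>i. {i} \<times> UNIV"]) (auto simp: f)
  moreover have "mends M (?h \<epsilon>) = f ` vertex_orbit cover shifts ` \<Union>\<epsilon>"
    if \<epsilon>: "\<epsilon> \<in> edge_orbits cover shifts" for \<epsilon>
  proof -
    obtain a where a: "a \<in> medges M" "\<epsilon> = fibre a"
      using \<epsilon> unfolding bij_betw_imp_surj_on[OF bij, symmetric] by blast
    have "f (vertex_orbit cover shifts u) = fst u" if "u \<in> \<Union>\<epsilon>" for u
    proof -
      have "fst u \<in> mverts M"
        using that ends[OF a(1)] edge_ends(1)[OF a(1)] a(2) by blast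
      then show ?thesis by (simp add: vertex_orbit_cover f)
    qed
    then have "f ` vertex_orbit cover shifts ` \<Union>\<epsilon> = fst ` \<Union>\<epsilon>"
      unfolding image_image by (rule image_cong[OF refl])
    then show ?thesis
      using a ends bij by (simp add: bij_betw_inv_into_left)
  qed
  ultimately have "multigraph_iso f ?h (quotient_multigraph cover shifts) M"
    using bij by (simp add: multigraph_iso_def quotient_multigraph_def bij_betw_inv_into)
  then show ?thesis using f by blast
qed

end

section \<open>Existence of the framework, and rational coordinates\<close>

text \<open>There are finitely many edge vectors, hence a common denominator of their coordinates; it
  serves for all sums of edge vectors along walks, hence for the whole group of periods.\<close>

lemma (in edge_vector_graph) lattice_of_rank_if_rational:
  assumes rat: "\<And>i j w s. w \<in> vecs i j \<Longrightarrow> w $ s \<in> \<rat>"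
    and span: "span (periodicity_vectors M e) = UNIV"
  shows "lattice_of_rank CARD('d) period_lattice"
proof -
  define F where "F = (\<Union>i\<in>mverts M. \<Union>j\<in>mverts M. \<Union>w\<in>vecs i j. range (($) w))"
  have "finite F"
    using finite_verts by (auto simp: F_def vecs_def)
  moreover have "F \<subseteq> \<rat>"
    using rat by (auto simp: F_def)
  ultimately obtain N :: nat where N: "N > 0" "\<And>t. t \<in> F \<Longrightarrow> of_nat N * t \<in> \<int>"
    by (rule rational_common_denominator) blast
  have walk_den: "of_nat N * v $ s \<in> \<int>" if "walk i j v" for i j v s
    using that
  proof (induction rule: walk.induct)
    case (stay u)
    show ?case by simp
  next
    case (step w u v z t)
    then have "w $ s \<in> F"
      using adj_verts(2,3)[OF vecs_adj[OF step.hyps(1)]] unfolding F_def by blast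
    then show ?case
      using step.IH N(2) by (simp add: distrib_left)
  qed
  obtain u where u: "u \<in> mverts M"
    using connected by (auto simp: connected_graph_def reduced_graph_def)
  show ?thesis
  proof (rule lattice_of_rank_if_bounded_denominators[OF _ _ _ N(1)])
    have "periodicity_vectors M e \<subseteq> period_lattice"
      by (auto intro: group_closure.base)
    then show "span period_lattice = UNIV"
      using span span_mono by blast
    show "of_nat N * v $ s \<in> \<int>" if "v \<in> period_lattice" for v s
      by (rule walk_den) (rule period_closed_walk[OF that u])
  qed (auto intro: group_closure.diff)
qed

theorem mainTheorem3:
  fixes M :: "(nat, 'e) multigraph"
    and n :: nat
    and x :: "nat \<Rightarrow> real ^ 'd"
    and e :: "nat \<Rightarrow> nat \<Rightarrow> nat \<Rightarrow> real ^ 'd"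
    and L :: "(real ^ 'd) set"
  assumes "CARD('d) \<ge> 2"
    and "multigraph M" and "finite_multigraph M" and "loopless M"
    and "mverts M = {..<n}"
    and "connected_graph (reduced_graph M)"
    and "\<And>i j. {i, j} \<in> sedges (reduced_graph M) \<Longrightarrow> x i \<noteq> x j"
    and "\<And>i j. {i, j} \<in> sedges (reduced_graph M) \<Longrightarrow>
           inj_on (e i j) {1..multiplicity_of M i j}"
    and "\<And>i j k. {i, j} \<in> sedges (reduced_graph M) \<Longrightarrow> k \<in> {1..multiplicity_of M i j} \<Longrightarrow>
           e i j k \<noteq> 0 \<and>
           x i + e i j k \<in> sphere (midpoint (x i) (x j)) (dist (x i) (x j) / 2) \<and>
           e j i k = - e i j k"
    and L: "L = group_closure (periodicity_vectors M e)"
  shows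
    "(lattice_of_rank CARD('d) L \<longrightarrow>
       (\<exists>(G :: (nat \<times> (int ^ 'd)) sgraph) \<Gamma> (p :: nat \<times> (int ^ 'd) \<Rightarrow> real ^ 'd) \<pi>.
          periodic_framework G \<Gamma> p \<pi> \<and>
          (\<exists>f h. multigraph_iso f h (quotient_multigraph G \<Gamma>) M \<and>
             (\<forall>A\<in>vertex_orbits G \<Gamma>. \<forall>B\<in>vertex_orbits G \<Gamma>.
                edge_vectors_between G p A B
                  = e (f A) (f B) ` {1..multiplicity_of M (f A) (f B)})) \<and>
          \<pi> ` \<Gamma> = L \<and>
          has_strictly_auxetic_deformation G \<Gamma> p \<pi>)) \<and>
     ((\<forall>i<n. \<forall>s. x i $ s \<in> \<rat>) \<and>
      (\<forall>i j k s. {i, j} \<in> sedges (reduced_graph M) \<and> k \<in> {1..multiplicity_of M i j} \<longrightarrow>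
         (x i + e i j k) $ s \<in> \<rat>) \<and>
      span (periodicity_vectors M e) = UNIV \<longrightarrow>
      lattice_of_rank CARD('d) L)"
proof (intro conjI impI)
  interpret edge_vector_graph M e
    by unfold_locales (use assms(2-4,6,8,9) in blast)+
  have thales: "inner w w = inner (x j - x i) w" if w: "w \<in> vecs i j" for w i j
  proof -
    obtain k where "k \<in> {1..multiplicity_of M i j}" "w = e i j k"
      using w by (auto simp: vecs_def)
    then show ?thesis
      using assms(9)[OF vecs_adj[OF w], of k] by (intro thales_sphere) simp
  qed
  obtain r where r: "r \<in> mverts M"
    using connected by (auto simp: connected_graph_def reduced_graph_def)
  {
    assume "lattice_of_rank CARD('d) L"
    then obtain A :: "real^'d^'d" where A: "det A \<noteq> 0" "L = range (\<lambda>z. A *v vec_of_int z)"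
      by (auto simp: lattice_of_full_rank_iff)
    interpret periodic_unfolding M e A r
      using A r L by unfold_locales simp_all
    obtain f h where f: "multigraph_iso f h (quotient_multigraph cover shifts) M"
        "\<And>i. i \<in> mverts M \<Longrightarrow> f ({i} \<times> UNIV) = i"
      using quotient_cover by blast
    have "has_strictly_auxetic_deformation cover shifts place shift_vec"
    proof (rule strictly_auxetic_if_spherical[OF periodic_framework_cover(1),
          where \<xi> = "\<lambda>u. x (fst u)"])
      show "x (fst (\<gamma> v)) = x (fst v)" if "\<gamma> \<in> shifts" "v \<in> sverts cover" for \<gamma> v
        using that by (auto elim!: shiftsE)
      show "inner (place w - place u) (place w - place u) =
          inner (x (fst w) - x (fst u)) (place w - place u)"
        if "{u, w} \<in> sedges cover" for u w
        using that by (intro thales) (simp add: sedges_cover)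
    qed
    moreover have "edge_vectors_between cover place B C
        = e (f B) (f C) ` {1..multiplicity_of M (f B) (f C)}"
      if BC: "B \<in> vertex_orbits cover shifts" "C \<in> vertex_orbits cover shifts" for B C
    proof -
      obtain i j where "i \<in> mverts M" "B = {i} \<times> UNIV" "j \<in> mverts M" "C = {j} \<times> UNIV"
        using BC by (auto simp: vertex_orbits_cover)
      then show ?thesis
        by (simp add: f(2) edge_vectors_cover) (simp add: vecs_def)
    qed
    ultimately show "\<exists>(G :: (nat \<times> (int ^ 'd)) sgraph) \<Gamma> (p :: nat \<times> (int ^ 'd) \<Rightarrow> real ^ 'd) \<pi>.
          periodic_framework G \<Gamma> p \<pi> \<and>
          (\<exists>f h. multigraph_iso f h (quotient_multigraph G \<Gamma>) M \<and>
             (\<forall>A\<in>vertex_orbits G \<Gamma>. \<forall>B\<in>vertex_orbits G \<Gamma>.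
                edge_vectors_between G p A B
                  = e (f A) (f B) ` {1..multiplicity_of M (f A) (f B)})) \<and>
          \<pi> ` \<Gamma> = L \<and>
          has_strictly_auxetic_deformation G \<Gamma> p \<pi>"
      using periodic_framework_cover f(1) unfolding L
      by (intro exI[of _ cover] exI[of _ shifts] exI[of _ place] exI[of _ shift_vec] conjI
          exI[of _ f] exI[of _ h]) simp_all
  }
  assume rat: "(\<forall>i<n. \<forall>s. x i $ s \<in> \<rat>) \<and>
      (\<forall>i j k s. {i, j} \<in> sedges (reduced_graph M) \<and> k \<in> {1..multiplicity_of M i j} \<longrightarrow>
         (x i + e i j k) $ s \<in> \<rat>) \<and>
      span (periodicity_vectors M e) = UNIV"
  have vecs_rat: "w $ s \<in> \<rat>" if w: "w \<in> vecs i j" for w i j s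
  proof -
    have adj: "adj i j" using w by (rule vecs_adj)
    then have "i < n" using adj_verts(2) assms(5) by blast
    then have "x i $ s \<in> \<rat>" "(x i + w) $ s \<in> \<rat>"
      using rat adj w by (auto simp: vecs_def)
    then have "(x i + w) $ s - x i $ s \<in> \<rat>" by (intro Rats_diff)
    then show ?thesis by simp
  qed
  have "span (periodicity_vectors M e) = UNIV" using rat by (elim conjE)
  then show "lattice_of_rank CARD('d) L"
    unfolding L by (intro lattice_of_rank_if_rational vecs_rat)
qed

end
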